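(* Let $G$ be a group that is generated as a semigroup by the finite set $\mathcal{G}$, and suppose that, for each $n \ge 0$, there are subsets $S_1(n), S_2(n)$ of $G$ satisfying the following conditions. (1) For each $n\ge 0$ and $i\in\{1,2\}$, each element of $S_i(n)$ can be represented by a word over $\mathcal{G}$ of length at most $n$. (2) There are constants $\alpha_0>0$, $\alpha_1>1$ such that for infinitely many $n$ we have $|S_i(n)| \geq \alpha_0\alpha_1^n$ for both $i=1$ and $i=2$. (3) For each $n \ge 0$, each element of $S_1(n)$ commutes with each element of $S_2(n)$. Then $G$ does not have a non-deterministic Cannon's algorithm over any finite semigroup generating set of $G$.
   Context: For a finite set $A$, $A^*$ denotes the set of all words over $A$, including the empty word $\epsilon$, and $|w|$ denotes the length of a word $w$. A non-deterministic Cannon's algorithm (NCA) is a triple $(X,\mathbb{A},\mathcal{R})$, where $X\subseteq \mathbb{A}$ are finite alphabets and $\mathcal{R}$ is a finite set of rules of the form $v\rightarrow u$ with $u,v\in \mathbb{A}^*$ and $|v|>|u|$. Distinct rules are allowed to have the same left hand side. Some of the rules may be anchored on the left, on the right, or on both sides. A non-anchored rule $v \rightarrow u$ may be applied to any occurrence of $v$ as a subword, replacing that occurrence by $u$ (so $w_1vw_2$ is replaced by $w_1uw_2$ for any $w_1,w_2\in\mathbb{A}^*$). A rule $v \rightarrow u$ anchored on the left, on the right, or on both sides may be applied only to the indicated subword $v$ in words of the form $vw$, $wv$, or $v$, respectively, with $w\in\mathbb{A}^*$ (giving $uw$, $wu$, or $u$). Write $w\rightarrow^* w'$ if $w'$ can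 be obtained from $w$ by a finite sequence (possibly empty) of rule applications. The language of the NCA is the set of words $w\in X^*$ with $w\rightarrow^*\epsilon$. If a group $G$ is generated as a semigroup by a finite set $X$, the word problem of $G$ over $X$ is the set of words in $X^*$ that represent the identity element of $G$ (including $\epsilon$). $G$ has a non-deterministic Cannon's algorithm over $X$ if there is an NCA $(X,\mathbb{A},\mathcal{R})$, for some finite alphabet $\mathbb{A}\supseteq X$, whose language is the word problem of $G$ over $X$. *)

theory Defs
  imports Complex_Main "HOL-Algebra.Group"
begin

datatype anchor = Free | Left_Anchored | Right_Anchored | Both_Anchored

text \<open>A rule (k, v, u) rewrites v to u, subject to the anchoring k.\<close>
type_synonym 'b nca_rule = "anchor \<times> 'b list \<times> 'b list"

record 'b nca =
  input_alphabet :: "'b set"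
  work_alphabet :: "'b set"
  nca_rules :: "'b nca_rule set"

definition is_nca :: "'b nca \<Rightarrow> bool" where
  "is_nca M \<longleftrightarrow>
     finite (work_alphabet M) \<and> input_alphabet M \<subseteq> work_alphabet M \<and> finite (nca_rules M) \<and>
     (\<forall>(k, v, u) \<in> nca_rules M.
        v \<in> lists (work_alphabet M) \<and> u \<in> lists (work_alphabet M) \<and> length u < length v)"

inductive nca_step :: "'b nca \<Rightarrow> 'b list \<Rightarrow> 'b list \<Rightarrow> bool" for M where
  free: "\<lbrakk>(Free, v, u) \<in> nca_rules M; w1 \<in> lists (work_alphabet M); w2 \<in> lists (work_alphabet M)\<rbrakk>
     \<Longrightarrow> nca_step M (w1 @ v @ w2) (w1 @ u @ w2)"
| left: "\<lbrakk>(Left_Anchored, v, u) \<in> nca_rules M; w \<in> lists (work_alphabet M)\<rbrakk>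
     \<Longrightarrow> nca_step M (v @ w) (u @ w)"
| right: "\<lbrakk>(Right_Anchored, v, u) \<in> nca_rules M; w \<in> lists (work_alphabet M)\<rbrakk>
     \<Longrightarrow> nca_step M (w @ v) (w @ u)"
| both: "(Both_Anchored, v, u) \<in> nca_rules M \<Longrightarrow> nca_step M v u"

definition nca_language :: "'b nca \<Rightarrow> 'b list set" where
  "nca_language M = {w \<in> lists (input_alphabet M). (nca_step M)\<^sup>*\<^sup>* w []}"

definition word_val :: "('a, 'm) monoid_scheme \<Rightarrow> 'a list \<Rightarrow> 'a" where
  "word_val G w = foldr (\<lambda>x y. x \<otimes>\<^bsub>G\<^esub> y) w \<one>\<^bsub>G\<^esub>"

text \<open>Generation as a semigroup: only products of nonempty words are used, and no inverses.\<close>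
definition semigroup_generates :: "('a, 'm) monoid_scheme \<Rightarrow> 'a set \<Rightarrow> bool" where
  "semigroup_generates G X \<longleftrightarrow>
     X \<subseteq> carrier G \<and> carrier G = word_val G ` (lists X - {[]})"

definition word_problem :: "('a, 'm) monoid_scheme \<Rightarrow> 'a set \<Rightarrow> 'a list set" where
  "word_problem G X = {w \<in> lists X. word_val G w = \<one>\<^bsub>G\<^esub>}"

text \<open>The working alphabet may need letters outside the group. A generator x is the letter Inl x,
  and the summand nat supplies unlimited further letters, so that every finite alphabet
  containing X occurs up to renaming of the letters not in X.\<close>
definition has_nca :: "('a, 'm) monoid_scheme \<Rightarrow> 'a set \<Rightarrow> bool" where
  "has_nca G X \<longleftrightarrow>
     (\<exists>M :: ('a + nat) nca. is_nca M \<and> input_alphabet M = Inl ` X \<and>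
        nca_language M = map Inl ` word_problem G X)"

end

theory Submission
  imports Defs
begin

text \<open>
The proof plays the length of short descriptions against the number of commuting pairs.

Let \<open>g\<close> and \<open>h\<close> commute and be represented by words \<open>u\<close> and \<open>v\<close>, and let \<open>u'\<close> and \<open>v'\<close> represent
their inverses. The word \<open>u v u' v'\<close> represents the identity, so it has a derivation to the empty
word. After end markers have absorbed the anchors (\<open>nca_language_iff\<close>), this is a derivation in an
ordinary length-reducing rewriting system. Draw it as a planar diagram with the first word on top. A gap
is a position between two letters of one of the words, and a path descends from a gap of the first
word to a later gap, crossing some of the rule applications on its way.

Two ideas are combined.

\<^item> Exchange. If two paths start at gaps of the first word and end close to each other, the subword
  between them interacts with its surroundings only through the rules that the paths cross. Two
  subwords with the same list of crossings and the same short remainder at the end of the paths can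
  be interchanged (\<open>cut_exchange\<close>). If the paths start in \<open>u\<close> and in \<open>u'\<close>, the subword contains \<open>v\<close>,
  and once \<open>g\<close> is fixed the crossings therefore determine \<open>h\<close>. Symmetrically, paths from \<open>v\<close> and
  \<open>v'\<close> determine \<open>g\<close> once \<open>h\<close> is fixed.

\<^item> Hyperbolicity. Each rule has fewer output letters than input letters, so every gap of the
  diagram is reached from the top with only logarithmically many crossings (\<open>letter_depths\<close>). Give
  each gap the side of the quadrilateral \<open>u v u' v'\<close> from which such a path reaches it. If opposite
  sides never came close, the winding number of these sides would be the same for all words of the
  derivation, as in Sperner's lemma. But it is 1 for the first word and 0 for the last. Hence
  two short paths that start on opposite sides meet (\<open>opposite_sides_linked\<close>).

A path with logarithmically many crossings has polynomially many possible descriptions. With \<open>D\<close> such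
descriptions, \<open>|S\<^sub>1| |S\<^sub>2| \<le> D (|S\<^sub>1| + |S\<^sub>2|)\<close> (\<open>commuting_sets_bound\<close>), so one of the two sets has at
most \<open>2 D\<close> elements. This contradicts exponential growth for large \<open>n\<close>.
\<close>

section \<open>Cutting a derivation along two short paths\<close>

type_synonym 'c srs = "('c list \<times> 'c list) set"

inductive rewrite :: "'c srs \<Rightarrow> 'c list \<Rightarrow> 'c list \<Rightarrow> bool" for R where
  "(v, u) \<in> R \<Longrightarrow> rewrite R (a @ v @ b) (a @ u @ b)"

text \<open>The rule that a path crosses, with the position at which the path enters its left-hand side and
the position at which it leaves the right-hand side.\<close>
type_synonym 'c crossing = "('c list \<times> 'c list) \<times> nat \<times> nat"

definition crossings :: "'c srs \<Rightarrow> nat \<Rightarrow> 'c crossing set" where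
  "crossings R K = R \<times> {..K} \<times> {..K}"

text \<open>The word is cut in three along two paths, and the next three relations follow the pieces
separately. A rule crossed by a path acts on each of the two adjacent pieces with its own part of
the left-hand side, and the list of crossings is all that either piece has to know about the other.
New crossings go to the end of the list, so that lists read downwards.\<close>
inductive left_part :: "'c srs \<Rightarrow> 'c crossing list \<Rightarrow> 'c list \<Rightarrow> 'c list \<Rightarrow> bool" for R where
  refl: "left_part R [] x x"
| rule: "\<lbrakk>left_part R \<sigma> x (a @ v @ b); (v, u) \<in> R\<rbrakk> \<Longrightarrow> left_part R \<sigma> x (a @ u @ b)"
| cross: "\<lbrakk>left_part R \<sigma> x (a @ take m v); (v, u) \<in> R\<rbrakk>
    \<Longrightarrow> left_part R (\<sigma> @ [((v, u), m, n)]) x (a @ take n u)"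

inductive right_part :: "'c srs \<Rightarrow> 'c crossing list \<Rightarrow> 'c list \<Rightarrow> 'c list \<Rightarrow> bool" for R where
  refl: "right_part R [] x x"
| rule: "\<lbrakk>right_part R \<tau> x (a @ v @ b); (v, u) \<in> R\<rbrakk> \<Longrightarrow> right_part R \<tau> x (a @ u @ b)"
| cross: "\<lbrakk>right_part R \<tau> x (drop m v @ b); (v, u) \<in> R\<rbrakk>
    \<Longrightarrow> right_part R (\<tau> @ [((v, u), m, n)]) x (drop n u @ b)"

inductive middle_part ::
  "'c srs \<Rightarrow> 'c crossing list \<Rightarrow> 'c crossing list \<Rightarrow> 'c list \<Rightarrow> 'c list \<Rightarrow> bool" for R where
  refl: "middle_part R [] [] x x"
| rule: "\<lbrakk>middle_part R \<sigma> \<tau> x (a @ v @ b); (v, u) \<in> R\<rbrakk> \<Longrightarrow> middle_part R \<sigma> \<tau> x (a @ u @ b)"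
| cross_left: "\<lbrakk>middle_part R \<sigma> \<tau> x (drop m v @ b); (v, u) \<in> R\<rbrakk>
    \<Longrightarrow> middle_part R (\<sigma> @ [((v, u), m, n)]) \<tau> x (drop n u @ b)"
| cross_right: "\<lbrakk>middle_part R \<sigma> \<tau> x (a @ take m v); (v, u) \<in> R\<rbrakk>
    \<Longrightarrow> middle_part R \<sigma> (\<tau> @ [((v, u), m, n)]) x (a @ take n u)"

lemma rewrites_context:
  assumes "(rewrite R)\<^sup>*\<^sup>* x y"
  shows "(rewrite R)\<^sup>*\<^sup>* (a @ x @ b) (a @ y @ b)"
  using assms
proof (induction rule: rtranclp_induct)
  case (step y z)
  from step.hyps(2) have "rewrite R (a @ y @ b) (a @ z @ b)"
  proof cases
    case (1 v u c d)
    then show ?thesis using rewrite.intros[of v u R "a @ c" "d @ b"] by simp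
  qed
  with step.IH show ?case by (rule rtranclp.rtrancl_into_rtrancl)
qed simp

lemma left_part_Nil: "left_part R [] x y \<Longrightarrow> (rewrite R)\<^sup>*\<^sup>* x y"
proof (induction "[] :: 'a crossing list" x y rule: left_part.induct)
  case (rule x a v b u)
  then show ?case by (meson rewrite.intros rtranclp.rtrancl_into_rtrancl)
qed simp_all

lemma right_part_Nil: "right_part R [] x y \<Longrightarrow> (rewrite R)\<^sup>*\<^sup>* x y"
proof (induction "[] :: 'a crossing list" x y rule: right_part.induct)
  case (rule x a v b u)
  then show ?case by (meson rewrite.intros rtranclp.rtrancl_into_rtrancl)
qed simp_all

lemma left_part_snoc:
  assumes "left_part R (\<sigma> @ [((v, u), m, n)]) x y"
  obtains a where "left_part R \<sigma> x (a @ take m v)" "(rewrite R)\<^sup>*\<^sup>* (a @ take n u) y"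
proof -
  have "\<exists>a. left_part R \<sigma> x (a @ take m v) \<and> (rewrite R)\<^sup>*\<^sup>* (a @ take n u) y"
    using assms
  proof (induction "\<sigma> @ [((v, u), m, n)]" x y rule: left_part.induct)
    case (rule x a v' b u')
    then show ?case by (meson rewrite.intros rtranclp.rtrancl_into_rtrancl)
  qed auto
  with that show thesis by blast
qed

lemma right_part_snoc:
  assumes "right_part R (\<tau> @ [((v, u), m, n)]) x y"
  obtains b where "right_part R \<tau> x (drop m v @ b)" "(rewrite R)\<^sup>*\<^sup>* (drop n u @ b) y"
proof -
  have "\<exists>b. right_part R \<tau> x (drop m v @ b) \<and> (rewrite R)\<^sup>*\<^sup>* (drop n u @ b) y"
    using assms
  proof (induction "\<tau> @ [((v, u), m, n)]" x y rule: right_part.induct)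
    case (rule x a v' b u')
    then show ?case by (meson rewrite.intros rtranclp.rtrancl_into_rtrancl)
  qed auto
  with that show thesis by blast
qed

text \<open>The pieces fit together because each crossing in \<open>\<sigma>\<close> or \<open>\<tau>\<close> tells both of its neighbours to apply
their parts of the same rule. Following the middle piece fixes the order of all crossings; the outer
pieces can wait for it, since they never touch each other.\<close>
lemma parts_reassemble:
  assumes "middle_part R \<sigma> \<tau> x z" "left_part R \<sigma> \<alpha> A" "right_part R \<tau> \<beta> B"
  shows "(rewrite R)\<^sup>*\<^sup>* (\<alpha> @ x @ \<beta>) (A @ z @ B)"
  using assms
proof (induction arbitrary: A B rule: middle_part.induct)
  case (refl x)
  have "(rewrite R)\<^sup>*\<^sup>* (\<alpha> @ x @ \<beta>) (A @ x @ \<beta>)"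
    using rewrites_context[OF left_part_Nil[OF refl(1)], of "[]"] by simp
  also have "(rewrite R)\<^sup>*\<^sup>* (A @ x @ \<beta>) (A @ x @ B)"
    using rewrites_context[OF right_part_Nil[OF refl(2)], of "A @ x" "[]"] by simp
  finally show ?case .
next
  case (rule \<sigma> \<tau> x a v b u)
  have "rewrite R ((A @ a) @ v @ b @ B) ((A @ a) @ u @ b @ B)"
    using rule.hyps(2) by (rule rewrite.intros)
  with rule.IH[OF rule.prems] show ?case
    by (simp add: rtranclp.rtrancl_into_rtrancl)
next
  case (cross_left \<sigma> \<tau> x m v b u n)
  obtain a where a: "left_part R \<sigma> \<alpha> (a @ take m v)" "(rewrite R)\<^sup>*\<^sup>* (a @ take n u) A"
    using left_part_snoc[OF cross_left.prems(1)] by blast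
  have "(rewrite R)\<^sup>*\<^sup>* (\<alpha> @ x @ \<beta>) ((a @ take m v) @ (drop m v @ b) @ B)"
    by (rule cross_left.IH[OF a(1) cross_left.prems(2)])
  also have "\<dots> = a @ v @ b @ B"
    by (metis append.assoc append_take_drop_id)
  also have "rewrite R (a @ v @ b @ B) (a @ u @ b @ B)"
    using cross_left.hyps(2) by (rule rewrite.intros)
  also have "a @ u @ b @ B = (a @ take n u) @ drop n u @ b @ B"
    by (metis append.assoc append_take_drop_id)
  also have "(rewrite R)\<^sup>*\<^sup>* \<dots> (A @ drop n u @ b @ B)"
    using rewrites_context[OF a(2), of "[]"] by simp
  finally show ?case by simp
next
  case (cross_right \<sigma> \<tau> x a m v u n)
  obtain b where b: "right_part R \<tau> \<beta> (drop m v @ b)" "(rewrite R)\<^sup>*\<^sup>* (drop n u @ b) B"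
    using right_part_snoc[OF cross_right.prems(2)] by blast
  have "(rewrite R)\<^sup>*\<^sup>* (\<alpha> @ x @ \<beta>) (A @ (a @ take m v) @ drop m v @ b)"
    by (rule cross_right.IH[OF cross_right.prems(1) b(1)])
  also have "\<dots> = (A @ a) @ v @ b"
    by (metis append.assoc append_take_drop_id)
  also have "rewrite R ((A @ a) @ v @ b) ((A @ a) @ u @ b)"
    using cross_right.hyps(2) by (rule rewrite.intros)
  also have "(A @ a) @ u @ b = (A @ a @ take n u) @ drop n u @ b"
    by (metis append.assoc append_take_drop_id)
  also have "(rewrite R)\<^sup>*\<^sup>* \<dots> ((A @ a @ take n u) @ B)"
    using rewrites_context[OF b(2), of "A @ a @ take n u" "[]"] by simp
  finally show ?case by simp
qed

definition cut_with :: "'c srs \<Rightarrow> 'c list \<Rightarrow> 'c list \<Rightarrow> 'c list \<Rightarrow> 'c list \<Rightarrow>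
    'c crossing list \<Rightarrow> 'c crossing list \<Rightarrow> 'c list \<Rightarrow> bool" where
  "cut_with R fin \<alpha> x \<beta> \<sigma> \<tau> z \<longleftrightarrow> (\<exists>A B. left_part R \<sigma> \<alpha> A \<and> middle_part R \<sigma> \<tau> x z \<and>
     right_part R \<tau> \<beta> B \<and> (rewrite R)\<^sup>*\<^sup>* (A @ z @ B) fin)"

text \<open>The outer pieces of the first derivation fit the middle piece of the second one, because the lists of
crossings agree; from there on the first derivation continues unchanged.\<close>
lemma cut_exchange:
  assumes "cut_with R fin \<alpha> x \<beta> \<sigma> \<tau> z" "cut_with R fin' \<alpha>' y \<beta>' \<sigma> \<tau> z"
  shows "(rewrite R)\<^sup>*\<^sup>* (\<alpha> @ y @ \<beta>) fin"
proof -
  obtain A B where AB: "left_part R \<sigma> \<alpha> A" "right_part R \<tau> \<beta> B" "(rewrite R)\<^sup>*\<^sup>* (A @ z @ B) fin"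
    using assms(1) unfolding cut_with_def by blast
  have "middle_part R \<sigma> \<tau> y z" using assms(2) unfolding cut_with_def by blast
  from parts_reassemble[OF this AB(1,2)] AB(3) show ?thesis by (rule rtranclp_trans)
qed

text \<open>The gaps of a word, moved to the next word when a rule rewrites its factor of length \<open>l\<close> at position
\<open>a\<close> to one of length \<open>l'\<close>. The index counts crossings. A gap outside the interior of the factor moves
freely; one that touches the factor may also cross to any gap that touches its replacement.\<close>
inductive gap_move :: "nat \<Rightarrow> nat \<Rightarrow> nat \<Rightarrow> nat \<Rightarrow> nat \<Rightarrow> nat \<Rightarrow> bool" for a l l' where
  before: "p \<le> a \<Longrightarrow> gap_move a l l' 0 p p"
| behind: "gap_move a l l' 0 (a + l + r) (a + l' + r)"
| across: "\<lbrakk>a \<le> p; p \<le> a + l; a \<le> p'; p' \<le> a + l'\<rbrakk> \<Longrightarrow> gap_move a l l' 1 p p'"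

lemma gap_move_before: "gap_move a l l' c p p' \<Longrightarrow> p < a \<Longrightarrow> p' = p \<and> c = 0"
  by (auto elim: gap_move.cases)

lemma append_eq_le:
  assumes "xs @ ys = zs @ ws" "length xs \<le> length zs"
  obtains c where "zs = xs @ c" "ys = c @ ws"
  using assms by (auto simp: append_eq_append_conv2)

text \<open>Unless the rule touches both cuts, it either acts inside one of the three pieces or is crossed by
exactly one of the two paths, and then it adds one entry to the list of that path. If it touches both, the
middle piece is no longer than the left-hand side, and the paths can stop there.\<close>
lemma split_step:
  assumes eq: "A @ z @ B = a @ v @ b" and R: "(v, u) \<in> R"
    and len: "length u < length v" "length v \<le> K"
    and parts: "left_part R \<sigma> \<alpha> A" "middle_part R \<sigma> \<tau> x z" "right_part R \<tau> \<beta> B"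
    and lists: "\<sigma> \<in> lists (crossings R K)" "\<tau> \<in> lists (crossings R K)"
    and p: "gap_move (length a) (length v) (length u) c p p'" "length A = p"
    and q: "gap_move (length a) (length v) (length u) d q q'" "length A + length z = q"
    and apart: "p < length a \<or> length a + length v < q"
  shows "\<exists>\<sigma>' \<tau>' A' z' B'. a @ u @ b = A' @ z' @ B' \<and> length A' = p' \<and> length A' + length z' = q' \<and>
    \<sigma>' \<in> lists (crossings R K) \<and> \<tau>' \<in> lists (crossings R K) \<and>
    length \<sigma>' \<le> length \<sigma> + c \<and> length \<tau>' \<le> length \<tau> + d \<and>
    left_part R \<sigma>' \<alpha> A' \<and> middle_part R \<sigma>' \<tau>' x z' \<and> right_part R \<tau>' \<beta> B'"
proof -
  have concl: ?thesis
    if "a @ u @ b = A' @ z' @ B'" "length A' = p'" "length A' + length z' = q'"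
      "\<sigma>' \<in> lists (crossings R K)" "\<tau>' \<in> lists (crossings R K)"
      "length \<sigma>' \<le> length \<sigma> + c" "length \<tau>' \<le> length \<tau> + d"
      "left_part R \<sigma>' \<alpha> A'" "middle_part R \<sigma>' \<tau>' x z'" "right_part R \<tau>' \<beta> B'"
    for \<sigma>' \<tau>' A' z' B'
    using that by blast
  show ?thesis
    using q(1)
  proof cases
    case q': before
    have "(A @ z) @ B = a @ v @ b" "length (A @ z) \<le> length a" using eq q q' by simp_all
    then obtain e where e: "a = (A @ z) @ e" "B = e @ v @ b" by (rule append_eq_le)
    have "p < length a" using apart p q q' by auto
    with gap_move_before[OF p(1)] have p': "p' = p" by auto
    have "right_part R \<tau> \<beta> (e @ u @ b)"
      using parts(3) R unfolding e(2) by (rule right_part.rule)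
    then show ?thesis
      using parts(1,2) lists p(2) q(2) p' q' e(1) by (intro concl[of A z "e @ u @ b" \<sigma> \<tau>]) simp_all
  next
    case q': (behind r)
    have "(a @ v) @ b = (A @ z) @ B" "length (a @ v) \<le> length (A @ z)"
      using eq q q' by simp_all
    then obtain e where e: "A @ z = (a @ v) @ e" "b = e @ B" by (rule append_eq_le)
    have r: "length e = r" using arg_cong[OF e(1), of length] q q' by simp
    show ?thesis using p(1)
    proof cases
      case p': before
      have "A @ z = a @ v @ e" "length A \<le> length a" using e p p' by simp_all
      then obtain f where f: "a = A @ f" "z = f @ v @ e" by (rule append_eq_le)
      have "middle_part R \<sigma> \<tau> x (f @ u @ e)"
        using parts(2) R unfolding f(2) by (rule middle_part.rule)
      then show ?thesis
        using parts(1,3) lists p(2) p' q' e(2) f(1) r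
        by (intro concl[of A "f @ u @ e" B \<sigma> \<tau>]) simp_all
    next
      case p': (behind r')
      have "(a @ v) @ e = A @ z" "length (a @ v) \<le> length A" using e p p' by simp_all
      then obtain f where f: "A = (a @ v) @ f" "e = f @ z" by (rule append_eq_le)
      have "left_part R \<sigma> \<alpha> (a @ v @ f)" using parts(1) f(1) by simp
      then have "left_part R \<sigma> \<alpha> (a @ u @ f)" using R by (rule left_part.rule)
      moreover have "length f = r'" using f(1) p(2) p' by simp
      ultimately show ?thesis
        using parts(2,3) lists p' q' e(2) f(2) r
        by (intro concl[of "a @ u @ f" z B \<sigma> \<tau>]) simp_all
    next
      case p': across
      have "a @ v @ e = A @ z" "length a \<le> length A" using e p p' by simp_all
      then obtain f where f: "A = a @ f" "v @ e = f @ z" by (rule append_eq_le)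
      have "f @ z = v @ e" "length f \<le> length v" using f p p' by simp_all
      then obtain g where g: "v = f @ g" "z = g @ e" by (rule append_eq_le)
      define m where "m = p - length a"
      define n where "n = p' - length a"
      have mf: "m = length f" using f(1) p(2) by (simp add: m_def)
      have m: "f = take m v" "g = drop m v" "m \<le> length v" using g(1) by (simp_all add: mf)
      have n: "n \<le> length u" "length a + n = p'" using p' by (simp_all add: n_def)
      let ?e = "((v, u), m, n)"
      have "left_part R \<sigma> \<alpha> (a @ take m v)" using parts(1) f(1) m(1) by simp
      then have "left_part R (\<sigma> @ [?e]) \<alpha> (a @ take n u)" using R by (rule left_part.cross)
      moreover have "middle_part R \<sigma> \<tau> x (drop m v @ e)" using parts(2) g(2) m(2) by simp
      then have "middle_part R (\<sigma> @ [?e]) \<tau> x (drop n u @ e)"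
        using R by (rule middle_part.cross_left)
      moreover have "?e \<in> crossings R K" using R m(3) n len by (simp add: crossings_def)
      ultimately show ?thesis using parts(3) lists p'(1) n q' e(2) r
        by (intro concl[of "a @ take n u" "drop n u @ e" B "\<sigma> @ [?e]" \<tau>]) simp_all
    qed
  next
    case q': across
    have pa: "p < length a" using apart q' by auto
    with gap_move_before[OF p(1)] have p': "p' = p" by auto
    have "A @ z @ B = a @ v @ b" "length A \<le> length a" using eq p pa by simp_all
    then obtain e where e: "a = A @ e" "z @ B = e @ v @ b" by (rule append_eq_le)
    have "e @ v @ b = z @ B" "length e \<le> length z" using e p q q' by simp_all
    then obtain f where f: "z = e @ f" "v @ b = f @ B" by (rule append_eq_le)
    have "f @ B = v @ b" "length f \<le> length v" using e f p q q' by simp_all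
    then obtain g where g: "v = f @ g" "B = g @ b" by (rule append_eq_le)
    define m where "m = q - length a"
    define n where "n = q' - length a"
    have mf: "m = length f" using e(1) f(1) p(2) q(2) by (simp add: m_def)
    have m: "f = take m v" "g = drop m v" "m \<le> length v" using g(1) by (simp_all add: mf)
    have n: "n \<le> length u" "length a + n = q'" using q' by (simp_all add: n_def)
    let ?e = "((v, u), m, n)"
    have "right_part R \<tau> \<beta> (drop m v @ b)" using parts(3) g(2) m(2) by simp
    then have "right_part R (\<tau> @ [?e]) \<beta> (drop n u @ b)" using R by (rule right_part.cross)
    moreover have "middle_part R \<sigma> \<tau> x (e @ take m v)" using parts(2) f(1) m(1) by simp
    then have "middle_part R \<sigma> (\<tau> @ [?e]) x (e @ take n u)"
      using R by (rule middle_part.cross_right)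
    moreover have "?e \<in> crossings R K" using R m(3) n len by (simp add: crossings_def)
    ultimately show ?thesis using parts(1) lists p(2) p' n q'(1) e(1)
      by (intro concl[of A "e @ take n u" "drop n u @ b" \<sigma> "\<tau> @ [?e]"]) simp_all
  qed
qed

section \<open>Every gap is close to the first word\<close>

locale shrinking_derivation =
  fixes R :: "'c srs" and K T :: nat and ws pre lhs rhs post :: "nat \<Rightarrow> 'c list"
  assumes shrink: "\<And>v u. (v, u) \<in> R \<Longrightarrow> length u < length v \<and> length v \<le> K"
    and rule: "\<And>t. t < T \<Longrightarrow> (lhs t, rhs t) \<in> R"
    and word: "\<And>t. t < T \<Longrightarrow> ws t = pre t @ lhs t @ post t"
    and next_word: "\<And>t. t < T \<Longrightarrow> ws (Suc t) = pre t @ rhs t @ post t"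
begin

lemma lengths: "t < T \<Longrightarrow> length (rhs t) < length (lhs t)" "t < T \<Longrightarrow> length (lhs t) \<le> K"
  using shrink[OF rule] by auto

lemma rewrites_to_last: "t \<le> T \<Longrightarrow> (rewrite R)\<^sup>*\<^sup>* (ws t) (ws T)"
proof (induction "T - t" arbitrary: t)
  case (Suc n)
  then have "t < T" by simp
  then have "rewrite R (ws t) (ws (Suc t))"
    using rewrite.intros[OF rule] by (simp add: word next_word)
  with Suc(1)[of "Suc t"] Suc(2) \<open>t < T\<close> show ?case
    by (simp add: converse_rtranclp_into_rtranclp)
qed simp

lemma word_alphabet:
  assumes "R \<subseteq> lists Al \<times> lists Al" "ws 0 \<in> lists Al" "t \<le> T"
  shows "ws t \<in> lists Al"
  using assms(3)
proof (induction t)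
  case (Suc t)
  then have "pre t @ lhs t @ post t \<in> lists Al" using word[of t] by simp
  moreover have "rhs t \<in> lists Al" using rule[of t] Suc.prems assms(1) by auto
  ultimately show ?case using next_word[of t] Suc.prems by simp
qed (use assms in simp)

lemma length_decreasing: "s \<le> t \<Longrightarrow> t \<le> T \<Longrightarrow> length (ws t) \<le> length (ws s)"
proof (induction t rule: dec_induct)
  case (step t)
  then show ?case using lengths(1)[of t] by (simp add: word next_word)
qed simp

text \<open>A path from the gap \<open>i\<close> of the first word has arrived at the gap \<open>p\<close> of the word \<open>ws t\<close> after \<open>k\<close> crossings.\<close>
inductive reach :: "nat \<Rightarrow> nat \<Rightarrow> nat \<Rightarrow> nat \<Rightarrow> bool" for i where
  start: "i \<le> length (ws 0) \<Longrightarrow> reach i 0 0 i"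
| move: "\<lbrakk>reach i t k p; t < T; gap_move (length (pre t)) (length (lhs t)) (length (rhs t)) c p p'\<rbrakk>
    \<Longrightarrow> reach i (Suc t) (k + c) p'"

inductive_cases reach_SucE: "reach i (Suc t) k p"

lemma reach_start: "reach i t k p \<Longrightarrow> i \<le> length (ws 0)"
  by (induction rule: reach.induct) auto

lemma reach_before: "reach i t k p \<Longrightarrow> t < T \<Longrightarrow> p \<le> length (pre t) \<Longrightarrow> reach i (Suc t) k p"
  using reach.move[OF _ _ gap_move.before] by fastforce

lemma reach_behind:
  "reach i t k (length (pre t) + length (lhs t) + r) \<Longrightarrow> t < T \<Longrightarrow>
    reach i (Suc t) k (length (pre t) + length (rhs t) + r)"
  using reach.move[OF _ _ gap_move.behind] by fastforce

lemma reach_across: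
  "reach i t k p \<Longrightarrow> t < T \<Longrightarrow> length (pre t) \<le> p \<Longrightarrow> p \<le> length (pre t) + length (lhs t) \<Longrightarrow>
    length (pre t) \<le> p' \<Longrightarrow> p' \<le> length (pre t) + length (rhs t) \<Longrightarrow> reach i (Suc t) (Suc k) p'"
  using reach.move[OF _ _ gap_move.across, of i t k p p'] by simp

lemma reach_left_end: "t \<le> T \<Longrightarrow> reach 0 t 0 0"
proof (induction t)
  case (Suc t)
  then show ?case by (intro reach_before) auto
qed (auto intro: reach.start)

lemma reach_right_end: "t \<le> T \<Longrightarrow> reach (length (ws 0)) t 0 (length (ws t))"
proof (induction t)
  case (Suc t)
  then have "reach (length (ws 0)) t 0 (length (pre t) + length (lhs t) + length (post t))"
    by (simp add: word add.assoc)
  with Suc.prems reach_behind show ?case by (fastforce simp: next_word add.assoc)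
qed (auto intro: reach.start)

text \<open>The factor by which the weight of a letter may grow at each crossing without increasing the total
weight: a rule replaces \<open>l \<le> K\<close> letters by at most \<open>l - 1\<close>, and \<open>(l - 1) (1 + 1 / K) \<le> l\<close>.\<close>
definition growth :: real where "growth = 1 + 1 / real K"

lemma growth_ge_1: "growth \<ge> 1" by (simp add: growth_def)

lemma growth_mult:
  assumes "l' < l" "l \<le> K"
  shows "real l' * growth \<le> real l"
proof -
  have "real l' / real K \<le> 1" using assms by (simp add: divide_le_eq)
  then show ?thesis using assms(1) unfolding growth_def by (simp add: algebra_simps)
qed

definition gap_depth :: "nat \<Rightarrow> nat \<Rightarrow> nat \<Rightarrow> bool" where
  "gap_depth t d p \<longleftrightarrow> (\<exists>i. reach i t d p)"

text \<open>Weigh a letter by \<open>growth ^ d\<close>, where \<open>d\<close> crossings suffice to reach the gaps on both of its sides.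
The letters produced by a rule are reached with one crossing more than the best of the letters that
it consumes, and there are fewer of them, so the total weight never exceeds its initial value, the
length of the first word. The depth of any single letter is then logarithmic in that length.\<close>
lemma letter_depths:
  "t \<le> T \<Longrightarrow> \<exists>ds. length ds = length (ws t) \<and> (\<Sum>d\<leftarrow>ds. growth ^ d) \<le> real (length (ws 0)) \<and>
     (\<forall>m < length ds. gap_depth t (ds ! m) m \<and> gap_depth t (ds ! m) (Suc m))"
proof (induction t)
  case 0
  have "gap_depth 0 0 m" if "m \<le> length (ws 0)" for m
    using reach.start[OF that] unfolding gap_depth_def ..
  then show ?case
    by (intro exI[of _ "replicate (length (ws 0)) 0"]) (auto simp: sum_list_replicate)
next
  case (Suc t)
  then have t: "t < T" by simp
  obtain ds where ds: "length ds = length (ws t)" "(\<Sum>d\<leftarrow>ds. growth ^ d) \<le> real (length (ws 0))"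
    "\<And>m. m < length ds \<Longrightarrow> gap_depth t (ds ! m) m \<and> gap_depth t (ds ! m) (Suc m)"
    using Suc by auto
  let ?a = "length (pre t)" and ?l = "length (lhs t)" and ?l' = "length (rhs t)"
  define d1 where "d1 = take ?a ds"
  define d2 where "d2 = take ?l (drop ?a ds)"
  define d3 where "d3 = drop ?l (drop ?a ds)"
  have split: "ds = d1 @ d2 @ d3" unfolding d1_def d2_def d3_def by (metis append_take_drop_id)
  have len: "length d1 = ?a" "length d2 = ?l" "length d3 = length (post t)"
    using ds(1) t by (simp_all add: d1_def d2_def d3_def word)
  have "d2 \<noteq> []" using len(2) lengths(1)[OF t] by auto
  \<comment> \<open>The cheapest consumed letter gives the way into the rule.\<close>
  define e where "e = Min (set d2)"
  have "e \<in> set d2" using \<open>d2 \<noteq> []\<close> by (simp add: e_def)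
  then obtain s where s: "s < ?l" "d2 ! s = e" using len by (auto simp: in_set_conv_nth)
  have "gap_depth t (ds ! (?a + s)) (?a + s)" using ds(3)[of "?a + s"] s len split by simp
  then have "gap_depth t e (?a + s)" using s len by (simp add: split nth_append)
  then have inner: "gap_depth (Suc t) (Suc e) p" if "?a \<le> p" "p \<le> ?a + ?l'" for p
    using reach_across[of _ t e "?a + s" p] that s(1) t unfolding gap_depth_def by auto
  define ds' where "ds' = d1 @ replicate ?l' (Suc e) @ d3"
  have "(\<Sum>d\<leftarrow>replicate ?l' (Suc e). growth ^ d) = real ?l' * growth * growth ^ e"
    by (simp add: sum_list_replicate map_replicate)
  also have "\<dots> \<le> real ?l * growth ^ e"
    using growth_mult[OF lengths[OF t]] growth_ge_1 by (intro mult_right_mono) simp_all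
  also have "\<dots> = (\<Sum>d\<leftarrow>d2. growth ^ e)"
    by (simp add: len sum_list_triv)
  also have "\<dots> \<le> (\<Sum>d\<leftarrow>d2. growth ^ d)"
    using growth_ge_1 by (intro sum_list_mono power_increasing) (auto simp: e_def)
  finally have "(\<Sum>d\<leftarrow>ds'. growth ^ d) \<le> (\<Sum>d\<leftarrow>ds. growth ^ d)"
    by (simp add: ds'_def split)
  moreover have "length ds' = length (ws (Suc t))"
    using t len by (simp add: ds'_def next_word)
  moreover have "gap_depth (Suc t) (ds' ! m) m \<and> gap_depth (Suc t) (ds' ! m) (Suc m)"
    if m: "m < length ds'" for m
  proof -
    consider "m < ?a" | "?a \<le> m" "m < ?a + ?l'" | r where "m = ?a + ?l' + r" "r < length d3"
      using m len unfolding ds'_def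
      by (metis add.assoc add_less_cancel_left le_add_diff_inverse length_append length_replicate
          linorder_not_le)
    then show ?thesis
    proof cases
      case 1
      then have "ds' ! m = ds ! m" using len by (simp add: ds'_def split nth_append)
      moreover have "gap_depth t (ds ! m) m" "gap_depth t (ds ! m) (Suc m)"
        using 1 ds(3)[of m] split len by simp_all
      ultimately show ?thesis
        unfolding gap_depth_def using 1 t reach_before by (metis Suc_leI less_imp_le)
    next
      case 2
      then have "m - ?a < ?l'" by linarith
      with 2 have "ds' ! m = Suc e" using len by (simp add: ds'_def nth_append)
      with 2 inner show ?thesis by simp
    next
      case 3
      have "ds' ! m = ds ! (?a + ?l + r)"
        using 3 len by (simp add: ds'_def split nth_append)
      moreover have "gap_depth t (ds ! (?a + ?l + r)) (?a + ?l + r)"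
        "gap_depth t (ds ! (?a + ?l + r)) (?a + ?l + Suc r)"
        using 3 ds(3)[of "?a + ?l + r"] split len by simp_all
      ultimately show ?thesis
        unfolding gap_depth_def 3(1) using t reach_behind by (metis add_Suc_right)
    qed
  qed
  ultimately show ?case using ds(2) by (intro exI[of _ ds']) auto
qed

lemma gap_depth_bound:
  assumes k: "real (length (ws 0)) < growth ^ Suc k"
    and t: "t \<le> T" and ne: "ws t \<noteq> []" and p: "p \<le> length (ws t)"
  obtains i d where "d \<le> k" "reach i t d p"
proof -
  obtain ds where ds: "length ds = length (ws t)" "(\<Sum>d\<leftarrow>ds. growth ^ d) \<le> real (length (ws 0))"
    "\<And>m. m < length ds \<Longrightarrow> gap_depth t (ds ! m) m \<and> gap_depth t (ds ! m) (Suc m)"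
    using letter_depths[OF t] by auto
  define m where "m = p - 1"
  have m: "m < length ds" "p = m \<or> p = Suc m" using ne p ds(1) by (cases "ws t"; auto simp: m_def)+
  have "growth ^ (ds ! m) \<le> (\<Sum>d\<leftarrow>ds. growth ^ d)"
    using m growth_ge_1 by (intro member_le_sum_list) (auto simp: zero_le_power)
  with ds(2) k have lt: "growth ^ (ds ! m) < growth ^ Suc k" by linarith
  have "ds ! m \<le> k"
  proof (rule ccontr)
    assume "\<not> ds ! m \<le> k"
    then have "growth ^ Suc k \<le> growth ^ (ds ! m)"
      by (intro power_increasing growth_ge_1) simp
    with lt show False by simp
  qed
  moreover have "gap_depth t (ds ! m) p" using ds(3) m by blast
  ultimately show thesis using that unfolding gap_depth_def by blast
qed

section \<open>Two paths that meet cut the first word\<close>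

text \<open>The paths from the gaps \<open>i\<close> and \<open>j\<close> of the first word have arrived at \<open>p\<close> and \<open>q\<close>, with at most \<open>k1\<close>
and \<open>k2\<close> crossings, and the three pieces of the first word have become those of \<open>ws t\<close>.\<close>
definition split_at :: "nat \<Rightarrow> nat \<Rightarrow> nat \<Rightarrow> nat \<Rightarrow> nat \<Rightarrow> nat \<Rightarrow> nat \<Rightarrow> bool" where
  "split_at t i j k1 k2 p q \<longleftrightarrow> (\<exists>\<sigma> \<tau> A z B. ws t = A @ z @ B \<and> length A = p \<and>
     length A + length z = q \<and> \<sigma> \<in> lists (crossings R K) \<and> \<tau> \<in> lists (crossings R K) \<and>
     length \<sigma> \<le> k1 \<and> length \<tau> \<le> k2 \<and> left_part R \<sigma> (take i (ws 0)) A \<and>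
     middle_part R \<sigma> \<tau> (drop i (take j (ws 0))) z \<and> right_part R \<tau> (drop j (ws 0)) B)"

text \<open>Paths that start in the order \<open>i \<le> j\<close> can only exchange their order inside a rule that both of them
touch. The second alternative stops at the first such rule, where the middle piece is part of its
left-hand side.\<close>
lemma split_at_paths:
  assumes "i \<le> j" "reach i t k1 p" "reach j t k2 q" "t \<le> T"
  shows "split_at t i j k1 k2 p q \<or>
    (\<exists>s\<le>T. \<exists>l1\<le>k1. \<exists>l2\<le>k2. \<exists>p' q'. split_at s i j l1 l2 p' q' \<and> q' \<le> p' + K)"
  using assms(2-4)
proof (induction t arbitrary: k1 k2 p q)
  case 0
  have "k1 = 0" "p = i" "k2 = 0" "q = j" "j \<le> length (ws 0)"
    using 0 reach_start[OF 0(2)] by (auto elim: reach.cases)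
  moreover have "ws 0 = take i (ws 0) @ drop i (take j (ws 0)) @ drop j (ws 0)"
    by (metis append.assoc append_take_drop_id assms(1) min.absorb1 take_take)
  ultimately have "split_at 0 i j k1 k2 p q" unfolding split_at_def using assms(1)
    by (intro exI[of _ "[]"] exI[of _ "take i (ws 0)"]
        exI[of _ "drop i (take j (ws 0))"] exI[of _ "drop j (ws 0)"])
      (simp add: left_part.refl middle_part.refl right_part.refl)
  then show ?case ..
next
  case (Suc t)
  let ?a = "length (pre t)" and ?l = "length (lhs t)" and ?l' = "length (rhs t)"
  obtain k c p0 where p0: "reach i t k p0" "gap_move ?a ?l ?l' c p0 p" "k1 = k + c"
    using Suc.prems(1) by (elim reach_SucE) auto
  obtain k' d q0 where q0: "reach j t k' q0" "gap_move ?a ?l ?l' d q0 q" "k2 = k' + d"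
    using Suc.prems(2) by (elim reach_SucE) auto
  have t: "t < T" using Suc.prems by simp
  from Suc.IH[OF p0(1) q0(1)] t consider "split_at t i j k k' p0 q0"
    | s l1 l2 p' q' where "s \<le> T" "l1 \<le> k" "l2 \<le> k'" "split_at s i j l1 l2 p' q'" "q' \<le> p' + K"
    by fastforce
  then show ?case
  proof cases
    case 1
    show ?thesis
    proof (cases "p0 < ?a \<or> ?a + ?l < q0")
      case False
      then have "q0 \<le> p0 + K" using lengths(2)[OF t] by simp
      with 1 t p0(3) q0(3) show ?thesis
        by (metis le_add1 less_imp_le)
    next
      case True
      obtain \<sigma> \<tau> A z B where D: "ws t = A @ z @ B" "length A = p0" "length A + length z = q0"
        "\<sigma> \<in> lists (crossings R K)" "\<tau> \<in> lists (crossings R K)" "length \<sigma> \<le> k" "length \<tau> \<le> k'"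
        "left_part R \<sigma> (take i (ws 0)) A"
        "middle_part R \<sigma> \<tau> (drop i (take j (ws 0))) z" "right_part R \<tau> (drop j (ws 0)) B"
        using 1 unfolding split_at_def by blast
      have "A @ z @ B = pre t @ lhs t @ post t" using D(1) word[OF t] by simp
      from split_step[OF this rule[OF t] lengths[OF t] D(8-10) D(4,5) p0(2) D(2) q0(2) D(3) True]
      obtain \<sigma>' \<tau>' A' z' B' where D': "pre t @ rhs t @ post t = A' @ z' @ B'"
        "length A' = p" "length A' + length z' = q"
        "\<sigma>' \<in> lists (crossings R K)" "\<tau>' \<in> lists (crossings R K)"
        "length \<sigma>' \<le> length \<sigma> + c" "length \<tau>' \<le> length \<tau> + d"
        "left_part R \<sigma>' (take i (ws 0)) A'"
        "middle_part R \<sigma>' \<tau>' (drop i (take j (ws 0))) z'" "right_part R \<tau>' (drop j (ws 0)) B'"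
        by blast
      have "length \<sigma>' \<le> k1" "length \<tau>' \<le> k2" using D(6,7) D'(6,7) p0(3) q0(3) by simp_all
      then have "split_at (Suc t) i j k1 k2 p q"
        unfolding split_at_def next_word[OF t] using D' by blast
      then show ?thesis ..
    qed
  next
    case 2
    then show ?thesis using p0(3) q0(3) by (meson trans_le_add1)
  qed
qed

text \<open>Paths that arrive on the two sides of a single letter also count as meeting; this makes neighbouring
gaps comparable in the winding argument.\<close>
definition linked :: "nat \<Rightarrow> nat \<Rightarrow> nat \<Rightarrow> bool" where
  "linked k i j \<longleftrightarrow> (\<exists>t\<le>T. \<exists>k1\<le>k. \<exists>k2\<le>k. \<exists>p q. reach i t k1 p \<and> reach j t k2 q \<and>
     p \<le> Suc q \<and> q \<le> Suc p)"

lemma linked_sym: "linked k i j \<Longrightarrow> linked k j i"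
  unfolding linked_def by blast

lemma linked_cut:
  assumes "linked k i j" "i \<le> j" "K \<ge> 1"
    and Al: "R \<subseteq> lists Al \<times> lists Al" "ws 0 \<in> lists Al"
  obtains \<sigma> \<tau> z where "\<sigma> \<in> lists (crossings R K)" "\<tau> \<in> lists (crossings R K)"
    "length \<sigma> \<le> k" "length \<tau> \<le> k" "z \<in> lists Al" "length z \<le> K"
    "cut_with R (ws T) (take i (ws 0)) (drop i (take j (ws 0))) (drop j (ws 0)) \<sigma> \<tau> z"
proof -
  obtain t k1 k2 p q where t: "t \<le> T" "k1 \<le> k" "k2 \<le> k" "reach i t k1 p" "reach j t k2 q"
    "p \<le> Suc q" "q \<le> Suc p"
    using assms(1) unfolding linked_def by blast
  have "q \<le> p + K" using t assms(3) by simp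
  with split_at_paths[OF assms(2) t(4,5,1)] t(1-3)
  obtain s l1 l2 p' q' where s: "s \<le> T" "l1 \<le> k" "l2 \<le> k" "split_at s i j l1 l2 p' q'" "q' \<le> p' + K"
    by (meson order_trans)
  then obtain \<sigma> \<tau> A z B where D: "ws s = A @ z @ B" "length A = p'" "length A + length z = q'"
    "\<sigma> \<in> lists (crossings R K)" "\<tau> \<in> lists (crossings R K)" "length \<sigma> \<le> l1" "length \<tau> \<le> l2"
    "left_part R \<sigma> (take i (ws 0)) A"
    "middle_part R \<sigma> \<tau> (drop i (take j (ws 0))) z" "right_part R \<tau> (drop j (ws 0)) B"
    unfolding split_at_def by blast
  have "z \<in> lists Al" using word_alphabet[OF Al s(1)] D(1) by simp
  moreover have "cut_with R (ws T) (take i (ws 0)) (drop i (take j (ws 0))) (drop j (ws 0)) \<sigma> \<tau> z"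
    using D rewrites_to_last[OF s(1)] unfolding cut_with_def by auto
  ultimately show thesis using D s by (intro that[of \<sigma> \<tau> z]) auto
qed

end

section \<open>A winding number forces opposite sides together\<close>

datatype side = First | Second | Third | Fourth

fun opposite :: "side \<Rightarrow> side \<Rightarrow> bool" where
  "opposite First Third = True"
| "opposite Third First = True"
| "opposite Second Fourth = True"
| "opposite Fourth Second = True"
| "opposite _ _ = False"

text \<open>Passing from the first side to the second is counted with its sign; this detects winding because a
loop around the four sides must cross that corner.\<close>
definition turn :: "side \<Rightarrow> side \<Rightarrow> int" where
  "turn x y = (if x = First \<and> y = Second then 1 else if x = Second \<and> y = First then - 1 else 0)"

text \<open>Three sides that are pairwise not opposite lie among two neighbouring ones, and there \<open>turn\<close> is a
difference of two values.\<close>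
lemma turn_add:
  assumes "\<not> opposite x y" "\<not> opposite y z" "\<not> opposite x z"
  shows "turn x y + turn y z = turn x z"
  using assms by (cases x; cases y; cases z) (simp_all add: turn_def)

definition winding :: "(nat \<Rightarrow> side) \<Rightarrow> nat \<Rightarrow> int" where
  "winding c n = (\<Sum>r<n. turn (c r) (c (Suc r)))"

lemma winding_Suc: "winding c (Suc n) = winding c n + turn (c n) (c (Suc n))"
  by (simp add: winding_def)

lemma winding_0 [simp]: "winding c 0 = 0"
  by (simp add: winding_def)

text \<open>Within the gaps of a single rule all sides are pairwise not opposite, so only the two ends count.\<close>
lemma winding_near:
  assumes "\<And>r s. r \<le> n \<Longrightarrow> s \<le> n \<Longrightarrow> \<not> opposite (c (m + r)) (c (m + s))"
  shows "winding c (m + n) = winding c m + turn (c m) (c (m + n))"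
proof -
  have "r \<le> n \<Longrightarrow> winding c (m + r) = winding c m + turn (c m) (c (m + r))" for r
  proof (induction r)
    case 0
    then show ?case by (cases "c m") (simp_all add: turn_def)
  next
    case (Suc r)
    have "turn (c m) (c (m + r)) + turn (c (m + r)) (c (m + Suc r)) = turn (c m) (c (m + Suc r))"
      using assms[of 0 r] assms[of r "Suc r"] assms[of 0 "Suc r"] Suc.prems
      by (intro turn_add) simp_all
    with Suc show ?case by (simp add: winding_Suc)
  qed
  then show ?thesis by simp
qed

text \<open>For two sequences of sides running in parallel, each square between them splits into two triangles
to which \<open>turn_add\<close> applies.\<close>
lemma winding_homotopy:
  assumes near: "\<And>r s. r \<le> n \<Longrightarrow> s \<le> n \<Longrightarrow> r \<le> Suc s \<Longrightarrow> s \<le> Suc r \<Longrightarrow>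
      \<not> opposite (f (m + r)) (f (m + s)) \<and> \<not> opposite (g (m' + r)) (g (m' + s)) \<and>
      \<not> opposite (f (m + r)) (g (m' + s))"
    and start: "winding g m' = winding f m + turn (f m) (g m')"
  shows "winding g (m' + n) = winding f (m + n) + turn (f (m + n)) (g (m' + n))"
proof -
  have "r \<le> n \<Longrightarrow> winding g (m' + r) = winding f (m + r) + turn (f (m + r)) (g (m' + r))" for r
  proof (induction r)
    case (Suc r)
    let ?f = "f (m + r)" and ?f1 = "f (m + Suc r)" and ?g = "g (m' + r)" and ?g1 = "g (m' + Suc r)"
    have "turn ?f ?g + turn ?g ?g1 = turn ?f ?g1" "turn ?f ?f1 + turn ?f1 ?g1 = turn ?f ?g1"
      using near[of r r] near[of r "Suc r"] near[of "Suc r" "Suc r"] Suc.prems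
      by (auto intro!: turn_add)
    with Suc show ?case by (simp add: winding_Suc)
  qed (use start in simp)
  then show ?thesis by simp
qed

context shrinking_derivation
begin

lemma linkedI:
  assumes "reach i t k1 p" "reach j t k2 q" "k1 \<le> k" "k2 \<le> k" "t \<le> T" "p \<le> Suc q" "q \<le> Suc p"
  shows "linked k i j"
  using assms unfolding linked_def by blast

text \<open>Every path to a gap touching the output of a rule comes through a gap touching its input, so it
could as well have crossed to any other gap of the output.\<close>
lemma reach_of_output:
  assumes "reach i (Suc t) k p" "length (pre t) \<le> p" "p \<le> length (pre t) + length (rhs t)"
  obtains p0 k0 where "reach i t k0 p0" "k0 \<le> k" "length (pre t) \<le> p0"
    "p0 \<le> length (pre t) + length (lhs t)"
proof -
  obtain k' p' c where m: "reach i t k' p'" "k = k' + c"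
    "gap_move (length (pre t)) (length (lhs t)) (length (rhs t)) c p' p"
    using assms(1) by (elim reach_SucE) auto
  from m(3) show thesis
    by cases (use m assms that in auto)
qed

text \<open>Left and right of the rewritten factor the two words run in parallel. At the factor all gaps, before
and after the step, have paths that can be led to its left end by one more crossing; that is why the
sides are required to stay apart for \<open>Suc k\<close> crossings when the given paths have at most \<open>k\<close>.\<close>
lemma winding_step:
  assumes t: "t < T"
    and origin: "\<And>s p. s \<le> T \<Longrightarrow> p \<le> length (ws s) \<Longrightarrow> \<exists>d\<le>k. reach (orig s p) s d p"
    and apart: "\<And>i j. linked (Suc k) i j \<Longrightarrow> \<not> opposite (col i) (col j)"
    and c: "\<And>s p. c s p = col (orig s p)"
    and left_end: "\<And>s. s \<le> T \<Longrightarrow> c s 0 = First"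
    and right_end: "\<And>s. s \<le> T \<Longrightarrow> c s (length (ws s)) = Fourth"
  shows "winding (c (Suc t)) (length (ws (Suc t))) = winding (c t) (length (ws t))"
proof -
  let ?a = "length (pre t)" and ?l = "length (lhs t)" and ?l' = "length (rhs t)"
    and ?r = "length (post t)"
  have len: "length (ws t) = ?a + ?l + ?r" "length (ws (Suc t)) = ?a + ?l' + ?r"
    using t by (simp_all add: word next_word)
  have near: "\<not> opposite (c s p) (c s q)"
    if pq: "s \<le> T" "p \<le> length (ws s)" "q \<le> length (ws s)" "p \<le> Suc q" "q \<le> Suc p" for s p q
  proof -
    obtain d e where "d \<le> k" "reach (orig s p) s d p" "e \<le> k" "reach (orig s q) s e q"
      using origin[of s p] origin[of s q] pq by blast
    then show ?thesis unfolding c using pq by (intro apart linkedI[of _ s d p _ e q]) auto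
  qed
  have before: "\<not> opposite (c t p) (c (Suc t) q)"
    if pq: "p \<le> ?a" "q \<le> ?a" "p \<le> Suc q" "q \<le> Suc p" for p q
  proof -
    obtain d e where "d \<le> k" "reach (orig t p) t d p" "e \<le> k" "reach (orig (Suc t) q) (Suc t) e q"
      using origin[of t p] origin[of "Suc t" q] pq t len by auto
    then show ?thesis unfolding c using pq t
      by (intro apart linkedI[of _ "Suc t" d p _ e q]) (auto intro: reach_before)
  qed
  have behind: "\<not> opposite (c t (?a + ?l + p)) (c (Suc t) (?a + ?l' + q))"
    if pq: "p \<le> ?r" "q \<le> ?r" "p \<le> Suc q" "q \<le> Suc p" for p q
  proof -
    obtain d e where "d \<le> k" "reach (orig t (?a + ?l + p)) t d (?a + ?l + p)" "e \<le> k"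
      "reach (orig (Suc t) (?a + ?l' + q)) (Suc t) e (?a + ?l' + q)"
      using origin[of t "?a + ?l + p"] origin[of "Suc t" "?a + ?l' + q"] pq t len by auto
    then show ?thesis unfolding c using pq t
      by (intro apart linkedI[of _ "Suc t" d "?a + ?l' + p" _ e "?a + ?l' + q"])
        (auto intro: reach_behind)
  qed
  \<comment> \<open>Every path to a gap around the rewritten factor can be led to the left end of its replacement.\<close>
  have hub: "\<exists>d\<le>Suc k. reach (orig t p) (Suc t) d ?a" if p: "?a \<le> p" "p \<le> ?a + ?l" for p
  proof -
    obtain d where "d \<le> k" "reach (orig t p) t d p" using origin[of t p] p t len by auto
    then show ?thesis using p t by (intro exI[of _ "Suc d"]) (auto intro: reach_across)
  qed
  have hub': "\<exists>d\<le>Suc k. reach (orig (Suc t) p) (Suc t) d ?a" if p: "?a \<le> p" "p \<le> ?a + ?l'" for p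
  proof -
    obtain d where "d \<le> k" "reach (orig (Suc t) p) (Suc t) d p"
      using origin[of "Suc t" p] p t len by auto
    with reach_of_output[OF this(2) p] obtain d0 p0 where
      "reach (orig (Suc t) p) t d0 p0" "d0 \<le> k" "?a \<le> p0" "p0 \<le> ?a + ?l"
      by (metis order_trans)
    then show ?thesis using t by (intro exI[of _ "Suc d0"]) (auto intro: reach_across)
  qed
  have at_hub: "linked (Suc k) i j"
    if "\<exists>d\<le>Suc k. reach i (Suc t) d ?a" "\<exists>d\<le>Suc k. reach j (Suc t) d ?a" for i j
    using that t by (auto intro: linkedI)
  have W1: "winding (c (Suc t)) ?a = winding (c t) ?a + turn (c t ?a) (c (Suc t) ?a)"
    using winding_homotopy[of ?a "c t" 0 "c (Suc t)" 0] near[of t] near[of "Suc t"] before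
      left_end[of t] left_end[of "Suc t"] t len
    by (simp add: turn_def)
  have W2: "winding (c t) (?a + ?l) = winding (c t) ?a + turn (c t ?a) (c t (?a + ?l))"
    using hub by (intro winding_near) (simp add: c apart at_hub)
  have W3: "winding (c (Suc t)) (?a + ?l')
      = winding (c (Suc t)) ?a + turn (c (Suc t) ?a) (c (Suc t) (?a + ?l'))"
    using hub' by (intro winding_near) (simp add: c apart at_hub)
  have "turn (c t ?a) (c (Suc t) ?a) + turn (c (Suc t) ?a) (c (Suc t) (?a + ?l'))
      = turn (c t ?a) (c (Suc t) (?a + ?l'))"
    "turn (c t ?a) (c t (?a + ?l)) + turn (c t (?a + ?l)) (c (Suc t) (?a + ?l'))
      = turn (c t ?a) (c (Suc t) (?a + ?l'))"
    using hub hub' by (auto intro!: turn_add simp: c apart at_hub)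
  with W1 W2 W3 have "winding (c (Suc t)) (?a + ?l')
      = winding (c t) (?a + ?l) + turn (c t (?a + ?l)) (c (Suc t) (?a + ?l'))"
    by linarith
  then have "winding (c (Suc t)) (?a + ?l' + ?r) = winding (c t) (?a + ?l + ?r)
      + turn (c t (?a + ?l + ?r)) (c (Suc t) (?a + ?l' + ?r))"
    using near[of t] near[of "Suc t"] behind t len
    by (intro winding_homotopy) simp_all
  then show ?thesis
    using right_end[of t] right_end[of "Suc t"] t len by (simp add: turn_def)
qed

text \<open>Let the gap positions \<open>i1\<close>, \<open>i2\<close>, \<open>i3\<close> end the first three sides. Were opposite sides never linked, the
winding number would be constant. But it is 1 for the first word, which runs through the sides in
order, and 0 for the last word, whose single inner gap is not opposite to either end.\<close>
lemma opposite_sides_linked: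
  assumes k: "real (length (ws 0)) < growth ^ Suc k"
    and last: "length (ws T) = 2"
    and sides: "i1 < i2" "i2 \<le> i3" "i3 < length (ws 0)"
  obtains i j where "linked (Suc k) i j" "j \<le> length (ws 0)"
    "i \<le> i1 \<and> i2 < j \<and> j \<le> i3 \<or> i1 < i \<and> i \<le> i2 \<and> i3 < j"
proof (rule ccontr)
  note result = that
  assume none: "\<not> thesis"
  define col where "col i = (if i \<le> i1 then First else if i \<le> i2 then Second
    else if i \<le> i3 then Third else Fourth)" for i
  have apart: "\<not> opposite (col i) (col j)" if "linked (Suc k) i j" for i j
  proof
    assume opp: "opposite (col i) (col j)"
    have le: "i \<le> length (ws 0)" "j \<le> length (ws 0)"
      using that reach_start unfolding linked_def by blast+
    have "i \<le> i1 \<and> i2 < j \<and> j \<le> i3 \<or> i1 < i \<and> i \<le> i2 \<and> i3 < j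
      \<or> j \<le> i1 \<and> i2 < i \<and> i \<le> i3 \<or> i1 < j \<and> j \<le> i2 \<and> i3 < i"
      using opp sides unfolding col_def by (auto split: if_splits)
    then show False using none result[of i j] result[of j i] le that linked_sym by blast
  qed
  have nonempty: "ws s \<noteq> []" if "s \<le> T" for s
    using length_decreasing[OF that order_refl] last by auto
  \<comment> \<open>The two outermost gaps are assigned to the outermost sides, as the winding argument needs
    fixed ends; the paths along both borders cross nothing.\<close>
  define orig where "orig s p = (if s = 0 then p else if p = 0 then 0
    else if p = length (ws s) then length (ws 0)
    else (SOME i. \<exists>d\<le>k. reach i s d p))" for s p
  have origin: "\<exists>d\<le>k. reach (orig s p) s d p" if s: "s \<le> T" "p \<le> length (ws s)" for s p
  proof -
    consider "s = 0" | "s \<noteq> 0" "p = 0" | "s \<noteq> 0" "p \<noteq> 0" "p = length (ws s)"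
      | "s \<noteq> 0" "p \<noteq> 0" "p \<noteq> length (ws s)" by blast
    then show ?thesis
    proof cases
      case 4
      have "\<exists>i. \<exists>d\<le>k. reach i s d p"
        using gap_depth_bound[OF k s(1) nonempty[OF s(1)] s(2)] by metis
      then have "\<exists>d\<le>k. reach (SOME i. \<exists>d\<le>k. reach i s d p) s d p" by (rule someI_ex)
      with 4 show ?thesis by (simp add: orig_def)
    qed (use s in \<open>auto simp: orig_def intro!: exI[of _ 0] reach.start reach_left_end reach_right_end\<close>)
  qed
  define c where "c s p = col (orig s p)" for s p
  have left_end: "c s 0 = First" if "s \<le> T" for s
    by (simp add: c_def col_def orig_def)
  have right_end: "c s (length (ws s)) = Fourth" if "s \<le> T" for s
    using sides nonempty[OF that] by (simp add: c_def col_def orig_def)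
  have invariant: "t \<le> T \<Longrightarrow> winding (c t) (length (ws t)) = winding (c 0) (length (ws 0))" for t
  proof (induction t)
    case (Suc t)
    have "winding (c (Suc t)) (length (ws (Suc t))) = winding (c t) (length (ws t))"
      by (rule winding_step[OF _ origin apart c_def left_end right_end]) (use Suc.prems in auto)
    with Suc show ?case by simp
  qed simp
  note invariant[OF order_refl]
  moreover have "winding (c 0) (length (ws 0)) = 1"
  proof -
    have "winding (c 0) p = (if p \<le> i1 then 0 else 1)" for p
      using sides by (induction p) (auto simp: winding_Suc turn_def c_def orig_def col_def)
    with sides show ?thesis by simp
  qed
  moreover have "winding (c T) (length (ws T)) = 0"
  proof -
    have end_near: "\<not> opposite (c T p) (c T (Suc p))" if p: "Suc p \<le> length (ws T)" for p
    proof -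
      obtain d e where "d \<le> k" "reach (orig T p) T d p" "e \<le> k" "reach (orig T (Suc p)) T e (Suc p)"
        using origin[of T p] origin[of T "Suc p"] p by auto
      then show ?thesis unfolding c_def by (intro apart linkedI[of _ T d p _ e "Suc p"]) auto
    qed
    have "c T 0 = First" "c T 2 = Fourth" using left_end[of T] right_end[of T] last by simp_all
    then have "\<not> opposite First (c T 1)" "\<not> opposite (c T 1) Fourth"
      using end_near[of 0] end_near[of 1] last by (simp_all add: numeral_2_eq_2)
    then show ?thesis using \<open>c T 0 = First\<close> \<open>c T 2 = Fourth\<close>
      unfolding last by (cases "c T 1") (simp_all add: winding_def numeral_2_eq_2 turn_def)
  qed
  ultimately show False by simp
qed

end

definition cut_labels :: "'c srs \<Rightarrow> nat \<Rightarrow> 'c set \<Rightarrow> nat \<Rightarrow> ('c crossing list \<times> 'c crossing list \<times> 'c list) set"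
  where "cut_labels R K Al k =
    {\<sigma>. set \<sigma> \<subseteq> crossings R K \<and> length \<sigma> \<le> k} \<times> {\<tau>. set \<tau> \<subseteq> crossings R K \<and> length \<tau> \<le> k} \<times>
    {z. set z \<subseteq> Al \<and> length z \<le> K}"

text \<open>The link between opposite sides, read off as a factorization of the word: it cuts out either the
second factor or the third one, together with adjacent parts of the opposite sides.\<close>
theorem quadrilateral_cut:
  assumes shrink: "\<forall>(v, u) \<in> R. length u < length v \<and> length v \<le> K"
    and derivation: "(rewrite R)\<^sup>*\<^sup>* (p1 @ p2 @ p3 @ p4) fin" and fin: "length fin = 2"
    and ne: "p2 \<noteq> []" "p4 \<noteq> []" and K: "K \<ge> 1"
    and Al: "R \<subseteq> lists Al \<times> lists Al" "p1 @ p2 @ p3 @ p4 \<in> lists Al"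
    and k: "real (length (p1 @ p2 @ p3 @ p4)) < (1 + 1 / real K) ^ Suc k"
  shows "(\<exists>a1 a2 c1 c2 \<sigma> \<tau> z. (\<sigma>, \<tau>, z) \<in> cut_labels R K Al (Suc k) \<and> p1 = a1 @ a2 \<and> p3 = c1 @ c2 \<and>
      cut_with R fin a1 (a2 @ p2 @ c1) (c2 @ p4) \<sigma> \<tau> z) \<or>
    (\<exists>b1 b2 d1 d2 \<sigma> \<tau> z. (\<sigma>, \<tau>, z) \<in> cut_labels R K Al (Suc k) \<and> p2 = b1 @ b2 \<and> p4 = d1 @ d2 \<and>
      cut_with R fin (p1 @ b1) (b2 @ p3 @ d1) d2 \<sigma> \<tau> z)"
proof -
  obtain T where "(rewrite R ^^ T) (p1 @ p2 @ p3 @ p4) fin"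
    using derivation by (meson rtranclp_imp_relpowp)
  then obtain ws where ws: "ws 0 = p1 @ p2 @ p3 @ p4" "ws T = fin"
    "\<And>t. t < T \<Longrightarrow> rewrite R (ws t) (ws (Suc t))"
    by (auto simp: relpowp_fun_conv)
  have "\<forall>t. \<exists>a v u b. t < T \<longrightarrow> (v, u) \<in> R \<and> ws t = a @ v @ b \<and> ws (Suc t) = a @ u @ b"
    using ws(3) by (metis rewrite.cases)
  then obtain pre lhs rhs post where steps: "\<And>t. t < T \<Longrightarrow> (lhs t, rhs t) \<in> R \<and>
      ws t = pre t @ lhs t @ post t \<and> ws (Suc t) = pre t @ rhs t @ post t"
    by metis
  interpret shrinking_derivation R K T ws pre lhs rhs post
    by standard (use shrink steps in auto)
  let ?i1 = "length p1" and ?i2 = "length (p1 @ p2)" and ?i3 = "length (p1 @ p2 @ p3)"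
  have "real (length (ws 0)) < growth ^ Suc k" using k by (simp add: ws growth_def)
  moreover have "length (ws T) = 2" using fin ws by simp
  moreover have "?i1 < ?i2" "?i2 \<le> ?i3" "?i3 < length (ws 0)" using ne ws by simp_all
  ultimately obtain i j where ij: "linked (Suc k) i j" "j \<le> length (ws 0)"
    "i \<le> ?i1 \<and> ?i2 < j \<and> j \<le> ?i3 \<or> ?i1 < i \<and> i \<le> ?i2 \<and> ?i3 < j"
    by (rule opposite_sides_linked)
  have "i \<le> j" using ij by auto
  obtain \<sigma> \<tau> z where cut: "\<sigma> \<in> lists (crossings R K)" "\<tau> \<in> lists (crossings R K)"
    "length \<sigma> \<le> Suc k" "length \<tau> \<le> Suc k" "z \<in> lists Al" "length z \<le> K"
    "cut_with R fin (take i (ws 0)) (drop i (take j (ws 0))) (drop j (ws 0)) \<sigma> \<tau> z"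
    using linked_cut[OF ij(1) \<open>i \<le> j\<close> K Al(1)] Al(2) ws by auto
  have lab: "(\<sigma>, \<tau>, z) \<in> cut_labels R K Al (Suc k)"
    using cut(1-6) by (auto simp: cut_labels_def)
  from ij(3) show ?thesis
  proof
    assume c: "i \<le> ?i1 \<and> ?i2 < j \<and> j \<le> ?i3"
    then obtain r where r: "j = ?i2 + r" by (metis less_imp_le nat_le_iff_add)
    have parts: "take i (ws 0) = take i p1"
      "drop i (take j (ws 0)) = drop i p1 @ p2 @ take r p3"
      "drop j (ws 0) = drop r p3 @ p4"
      using c r by (simp_all add: ws)
    have "cut_with R fin (take i p1) (drop i p1 @ p2 @ take r p3) (drop r p3 @ p4) \<sigma> \<tau> z"
      using cut(7) unfolding parts .
    with lab show ?thesis
      by (intro disjI1 exI[of _ "take i p1"] exI[of _ "drop i p1"] exI[of _ "take r p3"]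
          exI[of _ "drop r p3"] exI[of _ \<sigma>] exI[of _ \<tau>] exI[of _ z]) simp
  next
    assume c: "?i1 < i \<and> i \<le> ?i2 \<and> ?i3 < j"
    then obtain q r where r: "i = ?i1 + q" "j = ?i3 + r" by (metis less_imp_le nat_le_iff_add)
    have parts: "take i (ws 0) = p1 @ take q p2"
      "drop i (take j (ws 0)) = drop q p2 @ p3 @ take r p4"
      "drop j (ws 0) = drop r p4"
      using c r by (simp_all add: ws)
    have "cut_with R fin (p1 @ take q p2) (drop q p2 @ p3 @ take r p4) (drop r p4) \<sigma> \<tau> z"
      using cut(7) unfolding parts .
    with lab show ?thesis
      by (intro disjI2 exI[of _ "take q p2"] exI[of _ "drop q p2"] exI[of _ "take r p4"]
          exI[of _ "drop r p4"] exI[of _ \<sigma>] exI[of _ \<tau>] exI[of _ z]) simp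
  qed
qed

section \<open>End markers in place of anchors\<close>

datatype 'b marked = Left_End | Right_End | Sym 'b

definition anchored_left :: "anchor \<Rightarrow> bool" where
  "anchored_left k \<longleftrightarrow> k = Left_Anchored \<or> k = Both_Anchored"

definition anchored_right :: "anchor \<Rightarrow> bool" where
  "anchored_right k \<longleftrightarrow> k = Right_Anchored \<or> k = Both_Anchored"

text \<open>With a marker at each end of the word, the free rule that includes the marker does what the anchored
rule did.\<close>
definition mark :: "anchor \<Rightarrow> 'b list \<Rightarrow> 'b marked list" where
  "mark k w = (if anchored_left k then [Left_End] else []) @ map Sym w @
     (if anchored_right k then [Right_End] else [])"

lemmas mark_simps = mark_def anchored_left_def anchored_right_def

definition marked_rules :: "'b nca \<Rightarrow> 'b marked srs" where
  "marked_rules M = (\<lambda>(k, v, u). (mark k v, mark k u)) ` nca_rules M"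

abbreviation wrap :: "'b list \<Rightarrow> 'b marked list" where
  "wrap \<equiv> mark Both_Anchored"

lemma marked_rulesI: "(k, v, u) \<in> nca_rules M \<Longrightarrow> (mark k v, mark k u) \<in> marked_rules M"
  unfolding marked_rules_def by force

lemma rewrite_of_nca_step: "nca_step M w w' \<Longrightarrow> rewrite (marked_rules M) (wrap w) (wrap w')"
proof (induction rule: nca_step.induct)
  case (free v u w1 w2)
  from rewrite.intros[OF marked_rulesI[OF free(1)], of "Left_End # map Sym w1" "map Sym w2 @ [Right_End]"]
  show ?case by (simp add: mark_simps)
next
  case (left v u w)
  from rewrite.intros[OF marked_rulesI[OF left(1)], of "[]" "map Sym w @ [Right_End]"]
  show ?case by (simp add: mark_simps)
next
  case (right v u w)
  from rewrite.intros[OF marked_rulesI[OF right(1)], of "Left_End # map Sym w" "[]"]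
  show ?case by (simp add: mark_simps)
next
  case (both v u)
  from rewrite.intros[OF marked_rulesI[OF both(1)], of "[]" "[]"]
  show ?case by simp
qed

lemma wrap_eq: "wrap w = Left_End # map Sym w @ [Right_End]"
  by (simp add: mark_simps)

text \<open>Markers occur only at the ends of a wrapped word, so a marked left-hand side can occur only where its
anchors allow.\<close>
lemma wrap_factor:
  assumes "wrap w = a @ mark k v @ b" "v \<noteq> []"
  shows "\<exists>w1 w2. w = w1 @ v @ w2 \<and> (anchored_left k \<longrightarrow> w1 = []) \<and>
    (anchored_right k \<longrightarrow> w2 = []) \<and> (\<forall>u. a @ mark k u @ b = wrap (w1 @ u @ w2))"
proof -
  define l where "l = (if anchored_left k then [Left_End :: 'a marked] else [])"
  define r where "r = (if anchored_right k then [Right_End :: 'a marked] else [])"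
  have mark: "mark k u = l @ map Sym u @ r" for u by (simp add: mark_def l_def r_def)
  have eq: "Left_End # map Sym w @ [Right_End] = a @ l @ map Sym v @ r @ b"
    using assms(1) by (simp add: wrap_eq mark)
  obtain a' where a': "a @ l = Left_End # a'" "anchored_left k \<longrightarrow> a' = []"
  proof (cases "anchored_left k")
    case False
    then have "a \<noteq> []" using eq assms(2) by (cases v) (auto simp: l_def)
    then obtain a' where "a = Left_End # a'" using eq by (cases a) auto
    with False that show thesis by (auto simp: l_def)
  next
    case True
    have "a = []"
    proof (rule ccontr)
      assume "a \<noteq> []"
      then obtain a' where "a = Left_End # a'" using eq by (cases a) auto
      then have "map Sym w @ [Right_End] = a' @ Left_End # map Sym v @ r @ b"
        using eq True by (simp add: l_def)
      then have "Left_End \<in> set (map Sym w @ [Right_End])" by simp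
      then show False by auto
    qed
    with True that show thesis by (auto simp: l_def)
  qed
  obtain b' where b': "r @ b = b' @ [Right_End]" "anchored_right k \<longrightarrow> b' = []"
  proof (cases "anchored_right k")
    case False
    have "b \<noteq> []"
    proof
      assume "b = []"
      then have "(Left_End # map Sym w) @ [Right_End] = (a @ l) @ map Sym v"
        using eq False by (simp add: r_def)
      then have "last (map Sym v) = Right_End"
        using assms(2) by (metis last_appendR last_snoc map_is_Nil_conv)
      with assms(2) show False by (simp add: last_map)
    qed
    then obtain b' x where b: "b = b' @ [x]" by (metis rev_exhaust)
    have "(Left_End # map Sym w) @ [Right_End] = (a @ l @ map Sym v @ r @ b') @ [x]"
      using eq b by simp
    then have "x = Right_End" by (simp only: append1_eq_conv)
    with False b that show thesis by (auto simp: r_def)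
  next
    case True
    have "b = []"
    proof (rule ccontr)
      assume "b \<noteq> []"
      then obtain b' x where b: "b = b' @ [x]" by (metis rev_exhaust)
      have "(Left_End # map Sym w) @ [Right_End] = (a @ l @ map Sym v @ Right_End # b') @ [x]"
        using eq True b by (simp add: r_def)
      then have "Left_End # map Sym w = a @ l @ map Sym v @ Right_End # b'"
        by (simp only: append1_eq_conv)
      then have "Right_End \<in> set (Left_End # map Sym w)" by simp
      then show False by auto
    qed
    with True that show thesis by (auto simp: r_def)
  qed
  have whole: "a @ mark k u @ b = Left_End # a' @ map Sym u @ b' @ [Right_End]" for u
  proof -
    have "a @ mark k u @ b = (a @ l) @ map Sym u @ (r @ b)" by (simp add: mark)
    then show ?thesis by (simp only: a'(1) b'(1)) simp
  qed
  have "map Sym w = a' @ map Sym v @ b'"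
    using assms(1) whole[of v] by (simp add: wrap_eq)
  from iffD1[OF map_eq_append_conv this]
  obtain w1 x where x: "w = w1 @ x" "a' = map Sym w1" "map Sym x = map Sym v @ b'"
    by auto
  from iffD1[OF map_eq_append_conv x(3)]
  obtain v' w2 where w: "x = v' @ w2" "map Sym v = map Sym v'" "b' = map Sym w2"
    by auto
  have "inj (Sym :: 'a \<Rightarrow> 'a marked)" by (simp add: inj_def)
  then have "v' = v" using w(2) by (simp add: inj_map_eq_map)
  then have "w = w1 @ v @ w2" using x(1) w(1) by simp
  moreover have "anchored_left k \<longrightarrow> w1 = []" "anchored_right k \<longrightarrow> w2 = []"
    using a'(2) b'(2) x(2) w(3) by simp_all
  moreover have "\<forall>u. a @ mark k u @ b = wrap (w1 @ u @ w2)"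
    unfolding whole wrap_eq x(2) w(3) by simp
  ultimately show ?thesis by blast
qed

lemma nca_step_of_rewrite:
  assumes "is_nca M" "w \<in> lists (work_alphabet M)" "rewrite (marked_rules M) (wrap w) y"
  shows "\<exists>w' \<in> lists (work_alphabet M). y = wrap w' \<and> nca_step M w w'"
  using assms(3)
proof cases
  case (1 v' u' a b)
  then obtain k v u where r: "(k, v, u) \<in> nca_rules M" "v' = mark k v" "u' = mark k u"
    unfolding marked_rules_def by auto
  have uv: "v \<noteq> []" "u \<in> lists (work_alphabet M)"
    using assms(1) r(1) unfolding is_nca_def by fastforce+
  obtain w1 w2 where w: "w = w1 @ v @ w2" "anchored_left k \<Longrightarrow> w1 = []"
    "anchored_right k \<Longrightarrow> w2 = []" "\<And>u. a @ mark k u @ b = wrap (w1 @ u @ w2)"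
    using wrap_factor[of w a k v b] uv(1) 1(1) r(2) by blast
  have "nca_step M (w1 @ v @ w2) (w1 @ u @ w2)"
    using r(1) w(1-3) assms(2) by (cases k) (auto simp: anchored_left_def anchored_right_def intro: nca_step.intros)
  with w uv assms(2) 1(2) r(3) show ?thesis by (intro bexI[of _ "w1 @ u @ w2"]) auto
qed

lemma wrap_inj: "wrap w = wrap w' \<Longrightarrow> w = w'"
  unfolding wrap_eq by (simp add: inj_map_eq_map inj_def)

lemma nca_language_iff:
  assumes "is_nca M" "w \<in> lists (input_alphabet M)"
  shows "w \<in> nca_language M \<longleftrightarrow> (rewrite (marked_rules M))\<^sup>*\<^sup>* (wrap w) (wrap [])"
proof
  assume "w \<in> nca_language M"
  then have "(nca_step M)\<^sup>*\<^sup>* w []" by (simp add: nca_language_def)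
  then show "(rewrite (marked_rules M))\<^sup>*\<^sup>* (wrap w) (wrap [])"
    by (induction rule: converse_rtranclp_induct)
      (auto intro: converse_rtranclp_into_rtranclp dest: rewrite_of_nca_step)
next
  have w: "w \<in> lists (work_alphabet M)" using assms unfolding is_nca_def by auto
  assume "(rewrite (marked_rules M))\<^sup>*\<^sup>* (wrap w) (wrap [])"
  then have "\<exists>w' \<in> lists (work_alphabet M). wrap [] = wrap w' \<and> (nca_step M)\<^sup>*\<^sup>* w w'"
  proof (induction rule: rtranclp_induct)
    case base
    with w show ?case by blast
  next
    case (step y z)
    then show ?case using nca_step_of_rewrite[OF assms(1)]
      by (metis rtranclp.rtrancl_into_rtrancl)
  qed
  then show "w \<in> nca_language M" using assms(2) wrap_inj unfolding nca_language_def by blast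
qed

definition marked_alphabet :: "'b nca \<Rightarrow> 'b marked set" where
  "marked_alphabet M = {Left_End, Right_End} \<union> Sym ` work_alphabet M"

lemma mark_in_alphabet: "w \<in> lists (work_alphabet M) \<Longrightarrow> mark k w \<in> lists (marked_alphabet M)"
  by (auto simp: mark_def marked_alphabet_def)

lemma marked_rules_properties:
  assumes "is_nca M"
  obtains K where "K \<ge> 1" "\<forall>(v, u) \<in> marked_rules M. length u < length v \<and> length v \<le> K"
    "finite (marked_rules M)" "finite (marked_alphabet M)"
    "marked_rules M \<subseteq> lists (marked_alphabet M) \<times> lists (marked_alphabet M)"
proof -
  have fin: "finite (marked_rules M)" "finite (marked_alphabet M)"
    using assms by (auto simp: is_nca_def marked_rules_def marked_alphabet_def)
  define K where "K = Suc (\<Sum>(v, u) \<in> marked_rules M. length v)"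
  have rules: "length u < length v" "v \<in> lists (work_alphabet M)" "u \<in> lists (work_alphabet M)"
    if "(k, v, u) \<in> nca_rules M" for k v u
    using assms that unfolding is_nca_def by fastforce+
  have "length u < length v \<and> v \<in> lists (marked_alphabet M) \<and> u \<in> lists (marked_alphabet M)"
    if vu: "(v, u) \<in> marked_rules M" for v u
  proof -
    obtain k v0 u0 where r: "(k, v0, u0) \<in> nca_rules M" "v = mark k v0" "u = mark k u0"
      using vu unfolding marked_rules_def by auto
    have "length u < length v" using rules(1)[OF r(1)] unfolding r(2,3) by (simp add: mark_def)
    moreover have "v \<in> lists (marked_alphabet M)" "u \<in> lists (marked_alphabet M)"
      unfolding r(2,3) using rules(2,3)[OF r(1)] by (simp_all only: mark_in_alphabet)
    ultimately show ?thesis by blast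
  qed
  moreover have "length v \<le> K" if "(v, u) \<in> marked_rules M" for v u
    using member_le_sum[OF that, of "\<lambda>(v, u). length v"] fin(1) by (simp add: K_def)
  ultimately show thesis by (intro that[of K] fin) (auto simp: K_def)
qed

section \<open>Counting commuting pairs\<close>

lemma card_cut_labels:
  assumes "finite R" "finite Al"
  shows "finite (cut_labels R K Al k)"
    and "card (cut_labels R K Al k)
      \<le> (card (crossings R K) + 1) ^ k * (card (crossings R K) + 1) ^ k * card {z. set z \<subseteq> Al \<and> length z \<le> K}"
proof -
  have fin: "finite (crossings R K)" using assms(1) by (simp add: crossings_def)
  have "(\<Sum>i\<le>k. n ^ i) \<le> (n + 1) ^ k" for n k :: nat
  proof (induction k)
    case (Suc k)
    have "(\<Sum>i\<le>Suc k. n ^ i) \<le> (n + 1) ^ k + n * (n + 1) ^ k"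
      unfolding sum.atMost_Suc power_Suc
      by (intro add_mono Suc mult_le_mono2 power_mono) simp_all
    then show ?case by simp
  qed simp
  then have "card {\<sigma>. set \<sigma> \<subseteq> crossings R K \<and> length \<sigma> \<le> k} \<le> (card (crossings R K) + 1) ^ k"
    using card_lists_length_le[OF fin] by simp
  then show "card (cut_labels R K Al k) \<le> (card (crossings R K) + 1) ^ k *
      (card (crossings R K) + 1) ^ k * card {z. set z \<subseteq> Al \<and> length z \<le> K}"
    by (simp add: cut_labels_def card_cartesian_product mult.assoc mult_le_mono)
  show "finite (cut_labels R K Al k)"
    unfolding cut_labels_def by (intro finite_cartesian_product finite_lists_length_le fin assms)
qed

text \<open>A pair \<open>(g, h)\<close> covered by \<open>P\<close> is determined by \<open>g\<close> and its label, one covered by \<open>Q\<close> by \<open>h\<close> and its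
label.\<close>
lemma card_product_le_of_labels:
  assumes fin: "finite A" "finite B" "finite D"
    and covered: "\<And>g h. g \<in> A \<Longrightarrow> h \<in> B \<Longrightarrow> (\<exists>d\<in>D. P g h d) \<or> (\<exists>d\<in>D. Q g h d)"
    and P: "\<And>g h h' d. g \<in> A \<Longrightarrow> h \<in> B \<Longrightarrow> h' \<in> B \<Longrightarrow> P g h d \<Longrightarrow> P g h' d \<Longrightarrow> h = h'"
    and Q: "\<And>g g' h d. g \<in> A \<Longrightarrow> g' \<in> A \<Longrightarrow> h \<in> B \<Longrightarrow> Q g h d \<Longrightarrow> Q g' h d \<Longrightarrow> g = g'"
  shows "card A * card B \<le> card D * (card A + card B)"
proof -
  define E where "E = {x \<in> A \<times> B. \<exists>d\<in>D. P (fst x) (snd x) d}"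
  define E' where "E' = {x \<in> A \<times> B. \<exists>d\<in>D. Q (fst x) (snd x) d}"
  have sub: "E \<subseteq> A \<times> B" "E' \<subseteq> A \<times> B" by (auto simp: E_def E'_def)
  have "\<forall>x. \<exists>d. x \<in> E \<longrightarrow> d \<in> D \<and> P (fst x) (snd x) d" unfolding E_def by blast
  then obtain d where d: "\<And>x. x \<in> E \<Longrightarrow> d x \<in> D \<and> P (fst x) (snd x) (d x)" by metis
  have "\<forall>x. \<exists>d. x \<in> E' \<longrightarrow> d \<in> D \<and> Q (fst x) (snd x) d" unfolding E'_def by blast
  then obtain d' where d': "\<And>x. x \<in> E' \<Longrightarrow> d' x \<in> D \<and> Q (fst x) (snd x) (d' x)" by metis
  have "inj_on (\<lambda>x. (fst x, d x)) E"
  proof (rule inj_onI)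
    fix x y assume xy: "x \<in> E" "y \<in> E" "(fst x, d x) = (fst y, d y)"
    then have "P (fst x) (snd x) (d x)" "P (fst x) (snd y) (d x)" using d[of x] d[of y] by auto
    moreover have "fst x \<in> A" "snd x \<in> B" "snd y \<in> B" using xy sub by auto
    ultimately have "snd x = snd y" by (metis P)
    with xy show "x = y" by (simp add: prod_eq_iff)
  qed
  moreover have "(\<lambda>x. (fst x, d x)) ` E \<subseteq> A \<times> D" using d sub by auto
  ultimately have "card E \<le> card (A \<times> D)"
    by (rule card_inj_on_le) (simp add: fin)
  have "inj_on (\<lambda>x. (snd x, d' x)) E'"
  proof (rule inj_onI)
    fix x y assume xy: "x \<in> E'" "y \<in> E'" "(snd x, d' x) = (snd y, d' y)"
    then have "Q (fst x) (snd x) (d' x)" "Q (fst y) (snd x) (d' x)" using d'[of x] d'[of y] by auto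
    moreover have "fst x \<in> A" "fst y \<in> A" "snd x \<in> B" using xy sub by auto
    ultimately have "fst x = fst y" by (metis Q)
    with xy show "x = y" by (simp add: prod_eq_iff)
  qed
  moreover have "(\<lambda>x. (snd x, d' x)) ` E' \<subseteq> B \<times> D" using d' sub by auto
  ultimately have "card E' \<le> card (B \<times> D)"
    by (rule card_inj_on_le) (simp add: fin)
  have "A \<times> B = E \<union> E'" using covered by (fastforce simp: E_def E'_def)
  then have "card A * card B \<le> card E + card E'"
    by (metis card_cartesian_product card_Un_le)
  with \<open>card E \<le> card (A \<times> D)\<close> \<open>card E' \<le> card (B \<times> D)\<close>
  show ?thesis by (simp add: card_cartesian_product algebra_simps)
qed

context group
begin

lemma word_val_closed: "w \<in> lists (carrier G) \<Longrightarrow> word_val G w \<in> carrier G"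
  by (induction w) (auto simp: word_val_def)

lemma word_val_append:
  "v \<in> lists (carrier G) \<Longrightarrow> w \<in> lists (carrier G) \<Longrightarrow>
    word_val G (v @ w) = word_val G v \<otimes> word_val G w"
proof (induction v)
  case (Cons x v)
  then show ?case using word_val_closed[of v] word_val_closed[of w]
    by (simp add: word_val_def m_assoc)
qed (use word_val_closed in \<open>auto simp: word_val_def\<close>)

lemma commutator_eq_one:
  assumes "g \<in> carrier G" "h \<in> carrier G" "g' \<in> carrier G" "h' \<in> carrier G"
  shows "g \<otimes> (h \<otimes> (inv g' \<otimes> inv h')) = \<one> \<longleftrightarrow> g \<otimes> h = h' \<otimes> g'"
proof -
  have "g \<otimes> (h \<otimes> (inv g' \<otimes> inv h')) = (g \<otimes> h) \<otimes> inv (h' \<otimes> g')"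
    using assms by (simp add: m_assoc inv_mult_group)
  moreover have "(g \<otimes> h) \<otimes> inv (h' \<otimes> g') = \<one> \<longleftrightarrow> g \<otimes> h = h' \<otimes> g'"
    using assms by (metis inv_closed inv_equality inv_inv m_closed r_inv)
  ultimately show ?thesis by simp
qed

text \<open>Replacing letters by words over the other generating set costs a constant factor. The summand 1
leaves room for a nonempty word representing the identity: the second side of the quadrilateral must
not be empty.\<close>
lemma short_words:
  assumes "finite gens" "gens \<subseteq> carrier G" "finite X" "semigroup_generates G X"
  obtains L where "L \<ge> 1" "\<And>w. w \<in> lists gens \<Longrightarrow> \<exists>x \<in> lists X. x \<noteq> [] \<and>
      length x \<le> L * (length w + 1) \<and> word_val G x = word_val G w"
    "\<And>w. w \<in> lists gens \<Longrightarrow> \<exists>x \<in> lists X.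
      length x \<le> L * (length w + 1) \<and> word_val G x = inv (word_val G w)"
proof -
  have X: "X \<subseteq> carrier G" using assms(4) unfolding semigroup_generates_def by blast
  from assms(4) have image: "carrier G = word_val G ` (lists X - {[]})"
    unfolding semigroup_generates_def by (rule conjunct2)
  have "g \<in> word_val G ` (lists X - {[]})" if "g \<in> carrier G" for g
    using that by (simp only: image[symmetric])
  then have "\<forall>g\<in>carrier G. \<exists>x. x \<in> lists X \<and> x \<noteq> [] \<and> word_val G x = g"
    by fastforce
  from bchoice[OF this]
  obtain f where f: "\<And>g. g \<in> carrier G \<Longrightarrow> f g \<in> lists X \<and> f g \<noteq> [] \<and> word_val G (f g) = g"
    by blast
  define B where "B = insert \<one> (gens \<union> (\<lambda>g. inv g) ` gens)"
  have B: "finite B" "B \<subseteq> carrier G" using assms by (auto simp: B_def)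
  define L where "L = (\<Sum>g\<in>B. length (f g))"
  have L: "length (f g) \<le> L" if "g \<in> B" for g
    unfolding L_def using B(1) that by (intro member_le_sum) auto
  have "L \<ge> 1" using L[of \<one>] f[of \<one>] by (cases "f \<one>") (auto simp: B_def)
  moreover have "\<exists>x \<in> lists X. x \<noteq> [] \<and> length x \<le> L * (length w + 1) \<and> word_val G x = word_val G w"
    if "w \<in> lists gens" for w
    using that
  proof (induction w)
    case Nil
    then show ?case using f[of \<one>] L[of \<one>]
      by (intro bexI[of _ "f \<one>"]) (auto simp: B_def word_val_def)
  next
    case (Cons g w)
    then obtain x where x: "x \<in> lists X" "x \<noteq> []" "length x \<le> L * (length w + 1)"
      "word_val G x = word_val G w" by auto
    have g: "g \<in> B" "g \<in> carrier G" using Cons.hyps assms(2) by (auto simp: B_def)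
    have "word_val G (f g @ x) = word_val G (g # w)"
      using f[OF g(2)] x X by (subst word_val_append) (auto simp: word_val_def)
    with f[OF g(2)] x L[OF g(1)] show ?case
      by (intro bexI[of _ "f g @ x"]) (auto simp: algebra_simps)
  qed
  moreover have "\<exists>x \<in> lists X. length x \<le> L * (length w + 1) \<and> word_val G x = inv (word_val G w)"
    if "w \<in> lists gens" for w
    using that
  proof (induction w)
    case Nil
    then show ?case by (intro bexI[of _ "[]"]) (auto simp: word_val_def)
  next
    case (Cons g w)
    then obtain x where x: "x \<in> lists X" "length x \<le> L * (length w + 1)"
      "word_val G x = inv (word_val G w)" by auto
    have g: "inv g \<in> B" "g \<in> carrier G" "inv g \<in> carrier G" using Cons.hyps assms(2) by (auto simp: B_def)
    have "word_val G w \<in> carrier G" using Cons.hyps assms(2) by (intro word_val_closed) auto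
    then have "inv (word_val G (g # w)) = inv (word_val G w) \<otimes> inv g"
      using g by (simp add: word_val_def inv_mult_group)
    moreover have "word_val G (x @ f (inv g)) = inv (word_val G w) \<otimes> inv g"
      using f[OF g(3)] x X by (subst word_val_append) auto
    ultimately show ?case using f[OF g(3)] x L[OF g(1)]
      by (intro bexI[of _ "x @ f (inv g)"]) (auto simp: algebra_simps)
  qed
  ultimately show thesis by (rule that)
qed

text \<open>Label a pair \<open>(g, h)\<close> with the positions of a cut of \<open>u v u' v'\<close> inside the two opposite sides, with
its crossings and its remainder. If the cut contains all of \<open>v\<close>, two pairs with the same \<open>g\<close> and the same label can exchange
their cut parts, and \<open>u v\<^sub>2 u' v\<^sub>1'\<close> represents the identity for the words of \<open>h\<^sub>2\<close> and \<open>h\<^sub>1\<close>; as \<open>g\<close> commutes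
with both, \<open>h\<^sub>1 = h\<^sub>2\<close>. The other kind of cut is symmetric.\<close>
theorem commuting_sets_bound:
  fixes e :: "'a \<Rightarrow> 'c"
  assumes R: "\<forall>(v, u) \<in> R. length u < length v \<and> length v \<le> K" "finite R" "K \<ge> 1"
    and Al: "finite Al" "R \<subseteq> lists Al \<times> lists Al"
    and embed: "\<And>w. w \<in> lists X \<Longrightarrow> wrap (map e w) \<in> lists Al"
    and language: "\<And>w. w \<in> lists X \<Longrightarrow>
      (rewrite R)\<^sup>*\<^sup>* (wrap (map e w)) (wrap []) \<longleftrightarrow> word_val G w = \<one>"
    and X: "X \<subseteq> carrier G"
    and AB: "finite A" "finite B" "A \<subseteq> carrier G" "B \<subseteq> carrier G"
    and comm: "\<And>g h. g \<in> A \<Longrightarrow> h \<in> B \<Longrightarrow> g \<otimes> h = h \<otimes> g"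
    and words: "\<And>g. g \<in> A \<union> B \<Longrightarrow> \<exists>x\<in>lists X. x \<noteq> [] \<and> length x \<le> l \<and> word_val G x = g"
    and inv_words: "\<And>g. g \<in> A \<union> B \<Longrightarrow> \<exists>x\<in>lists X. length x \<le> l \<and> word_val G x = inv g"
    and k: "real (4 * l + 2) < (1 + 1 / real K) ^ Suc k"
  shows "card A * card B \<le> card ({..l + 1} \<times> {..l + 1} \<times> cut_labels R K Al (Suc k)) * (card A + card B)"
proof -
  obtain U where U: "\<And>g. g \<in> A \<union> B \<Longrightarrow> U g \<in> lists X \<and> U g \<noteq> [] \<and> length (U g) \<le> l \<and> word_val G (U g) = g"
    using words by metis
  obtain V where V: "\<And>g. g \<in> A \<union> B \<Longrightarrow> V g \<in> lists X \<and> length (V g) \<le> l \<and> word_val G (V g) = inv g"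
    using inv_words by metis
  define s where "s w = map (Sym \<circ> e) w" for w
  \<comment> \<open>The right marker joins the fourth side and the left marker the first.\<close>
  define p1 where "p1 g = Left_End # s (U g)" for g
  define p4 where "p4 h = s (V h) @ [Right_End]" for h
  have s_len [simp]: "length (s w) = length w" for w by (simp add: s_def)
  have wrap: "p1 g @ s (U h) @ s (V g') @ p4 h' = wrap (map e (U g @ U h @ V g' @ V h'))" for g h g' h'
    by (simp add: p1_def p4_def s_def wrap_eq)
  have trivial: "(rewrite R)\<^sup>*\<^sup>* (p1 g @ s (U h) @ s (V g') @ p4 h') (wrap []) \<longleftrightarrow> g \<otimes> h = h' \<otimes> g'"
    if gh: "g \<in> A" "h \<in> B" "g' \<in> A" "h' \<in> B" for g h g' h'
  proof -
    have in_X: "U g \<in> lists X" "U h \<in> lists X" "V g' \<in> lists X" "V h' \<in> lists X"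
      using U V gh by auto
    then have in_G: "U g \<in> lists (carrier G)" "U h \<in> lists (carrier G)" "V g' \<in> lists (carrier G)"
      "V h' \<in> lists (carrier G)" using X by auto
    have "word_val G (U g @ U h @ V g' @ V h') = g \<otimes> (h \<otimes> (inv g' \<otimes> inv h'))"
      using in_G U V gh by (simp add: word_val_append)
    moreover have "g \<in> carrier G" "h \<in> carrier G" "g' \<in> carrier G" "h' \<in> carrier G"
      using gh AB by auto
    ultimately show ?thesis
      unfolding wrap using language[of "U g @ U h @ V g' @ V h'"] in_X
      by (simp add: commutator_eq_one)
  qed
  define P where "P g h d = (case d of (m, n, \<sigma>, \<tau>, z) \<Rightarrow> \<exists>a1 a2 c1 c2. p1 g = a1 @ a2 \<and>
      s (V g) = c1 @ c2 \<and> length a1 = m \<and> length c1 = n \<and>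
      cut_with R (wrap []) a1 (a2 @ s (U h) @ c1) (c2 @ p4 h) \<sigma> \<tau> z)" for g h d
  define Q where "Q g h d = (case d of (m, n, \<sigma>, \<tau>, z) \<Rightarrow> \<exists>b1 b2 d1 d2. s (U h) = b1 @ b2 \<and>
      p4 h = d1 @ d2 \<and> length b1 = m \<and> length d1 = n \<and>
      cut_with R (wrap []) (p1 g @ b1) (b2 @ s (V g) @ d1) d2 \<sigma> \<tau> z)" for g h d
  show ?thesis
  proof (rule card_product_le_of_labels[where P = P and Q = Q])
    show "finite A" "finite B" by fact+
    show "finite ({..l + 1} \<times> {..l + 1} \<times> cut_labels R K Al (Suc k))"
      using card_cut_labels(1)[OF R(2) Al(1)] by simp
  next
    fix g h assume gh: "g \<in> A" "h \<in> B"
    let ?w = "p1 g @ s (U h) @ s (V g) @ p4 h"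
    have lens: "length (U g) \<le> l" "length (U h) \<le> l" "length (V g) \<le> l" "length (V h) \<le> l"
      using U V gh by auto
    have derivation: "(rewrite R)\<^sup>*\<^sup>* ?w (wrap [])"
      using trivial[OF gh gh] comm[OF gh] by simp
    have final: "length (wrap [] :: 'c marked list) = 2" by (simp add: wrap_eq)
    have ne: "s (U h) \<noteq> []" "p4 h \<noteq> []" using U[of h] gh by (auto simp: s_def p4_def)
    have alphabet: "?w \<in> lists Al" unfolding wrap using U V gh by (intro embed) auto
    have "length ?w \<le> 4 * l + 2" using lens by (simp add: p1_def p4_def)
    then have small: "real (length ?w) < (1 + 1 / real K) ^ Suc k" using k by linarith
    from quadrilateral_cut[OF R(1) derivation final ne R(3) Al(2) alphabet small]
    show "(\<exists>d\<in>{..l + 1} \<times> {..l + 1} \<times> cut_labels R K Al (Suc k). P g h d) \<or>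
        (\<exists>d\<in>{..l + 1} \<times> {..l + 1} \<times> cut_labels R K Al (Suc k). Q g h d)"
    proof (elim disjE exE conjE)
      fix a1 a2 c1 c2 \<sigma> \<tau> z
      assume label: "(\<sigma>, \<tau>, z) \<in> cut_labels R K Al (Suc k)"
        and eq: "p1 g = a1 @ a2" "s (V g) = c1 @ c2"
        and cut: "cut_with R (wrap []) a1 (a2 @ s (U h) @ c1) (c2 @ p4 h) \<sigma> \<tau> z"
      have "P g h (length a1, length c1, \<sigma>, \<tau>, z)"
        unfolding P_def prod.case using eq cut by blast
      moreover have "length a1 \<le> l + 1" "length c1 \<le> l + 1"
        using arg_cong[OF eq(1), of length] arg_cong[OF eq(2), of length] lens
        by (simp_all add: p1_def)
      ultimately show ?thesis
        using label by (intro disjI1 bexI[of _ "(length a1, length c1, \<sigma>, \<tau>, z)"]) simp_all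
    next
      fix b1 b2 d1 d2 \<sigma> \<tau> z
      assume label: "(\<sigma>, \<tau>, z) \<in> cut_labels R K Al (Suc k)"
        and eq: "s (U h) = b1 @ b2" "p4 h = d1 @ d2"
        and cut: "cut_with R (wrap []) (p1 g @ b1) (b2 @ s (V g) @ d1) d2 \<sigma> \<tau> z"
      have "Q g h (length b1, length d1, \<sigma>, \<tau>, z)"
        unfolding Q_def prod.case using eq cut by blast
      moreover have "length b1 \<le> l + 1" "length d1 \<le> l + 1"
        using arg_cong[OF eq(1), of length] arg_cong[OF eq(2), of length] lens
        by (simp_all add: p4_def)
      ultimately show ?thesis
        using label by (intro disjI2 bexI[of _ "(length b1, length d1, \<sigma>, \<tau>, z)"]) simp_all
    qed
  next
    fix g h h' d assume gh: "g \<in> A" "h \<in> B" "h' \<in> B" and PP: "P g h d" "P g h' d"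
    obtain m n \<sigma> \<tau> z where d: "d = (m, n, \<sigma>, \<tau>, z)" by (cases d) auto
    obtain a1 a2 c1 c2 where 1: "p1 g = a1 @ a2" "s (V g) = c1 @ c2" "length a1 = m" "length c1 = n"
      "cut_with R (wrap []) a1 (a2 @ s (U h) @ c1) (c2 @ p4 h) \<sigma> \<tau> z"
      using PP(1) by (auto simp: P_def d)
    obtain a1' a2' c1' c2' where 2: "p1 g = a1' @ a2'" "s (V g) = c1' @ c2'" "length a1' = m"
      "length c1' = n" "cut_with R (wrap []) a1' (a2' @ s (U h') @ c1') (c2' @ p4 h') \<sigma> \<tau> z"
      using PP(2) by (auto simp: P_def d)
    have "a1' = a1" "a2' = a2" "c1' = c1" "c2' = c2" using 1(1-4) 2(1-4) by auto
    with cut_exchange[OF 1(5) 2(5)] 1(1,2)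
    have "(rewrite R)\<^sup>*\<^sup>* (p1 g @ s (U h') @ s (V g) @ p4 h) (wrap [])" by simp
    with trivial[OF gh(1,3,1,2)] comm[OF gh(1,2)] have "g \<otimes> h' = g \<otimes> h" by simp
    with gh AB show "h = h'" by (metis Units_l_cancel Units_eq subsetD)
  next
    fix g g' h d assume gh: "g \<in> A" "g' \<in> A" "h \<in> B" and QQ: "Q g h d" "Q g' h d"
    obtain m n \<sigma> \<tau> z where d: "d = (m, n, \<sigma>, \<tau>, z)" by (cases d) auto
    obtain b1 b2 d1 d2 where 1: "s (U h) = b1 @ b2" "p4 h = d1 @ d2" "length b1 = m" "length d1 = n"
      "cut_with R (wrap []) (p1 g @ b1) (b2 @ s (V g) @ d1) d2 \<sigma> \<tau> z"
      using QQ(1) by (auto simp: Q_def d)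
    obtain b1' b2' d1' d2' where 2: "s (U h) = b1' @ b2'" "p4 h = d1' @ d2'" "length b1' = m"
      "length d1' = n" "cut_with R (wrap []) (p1 g' @ b1') (b2' @ s (V g') @ d1') d2' \<sigma> \<tau> z"
      using QQ(2) by (auto simp: Q_def d)
    have "b1' = b1" "b2' = b2" "d1' = d1" "d2' = d2" using 1(1-4) 2(1-4) by auto
    with cut_exchange[OF 1(5) 2(5)] 1(1,2)
    have "(rewrite R)\<^sup>*\<^sup>* (p1 g @ s (U h) @ s (V g') @ p4 h) (wrap [])" by simp
    with trivial[OF gh(1,3,2,3)] comm[OF gh(1,3)] have "h \<otimes> g = h \<otimes> g'" by simp
    with gh AB show "g = g'" by (metis Units_l_cancel Units_eq subsetD)
  qed
qed

end

lemma polynomial_less_exponential: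
  fixes a b c :: real
  assumes "a > 1" "b > 0"
  shows "eventually (\<lambda>n. c * (real n + 1) ^ r < b * a ^ n) sequentially"
proof -
  have ln: "ln a > 0" using assms by simp
  have "filterlim (\<lambda>n. 1 + real n) at_top sequentially"
    by (rule filterlim_tendsto_add_at_top[OF tendsto_const filterlim_real_sequentially])
  from filterlim_tendsto_pos_mult_at_top[OF tendsto_const ln this]
  have lim: "filterlim (\<lambda>n. ln a * (real n + 1)) at_top sequentially" by (simp add: add.commute)
  define \<epsilon> where "\<epsilon> = b * ln a ^ r / ((\<bar>c\<bar> + 1) * a)"
  have \<epsilon>: "\<epsilon> > 0" using assms ln by (simp add: \<epsilon>_def)
  have "eventually (\<lambda>n. (ln a * (real n + 1)) ^ r / exp (ln a * (real n + 1)) < \<epsilon>) sequentially"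
    by (rule order_tendstoD(2)[OF filterlim_compose[OF tendsto_power_div_exp_0 lim] \<epsilon>])
  then show ?thesis
  proof eventually_elim
    case (elim n)
    have e: "exp (ln a * (real n + 1)) = a ^ n * a"
      using assms by (simp add: distrib_left exp_add exp_of_nat2_mult)
    have "ln a ^ r * (real n + 1) ^ r < \<epsilon> * (a ^ n * a)"
      using elim assms unfolding e by (simp add: divide_less_eq power_mult_distrib)
    also have "\<dots> = ln a ^ r * (b * a ^ n / (\<bar>c\<bar> + 1))"
      using assms by (simp add: \<epsilon>_def)
    finally have "(real n + 1) ^ r < b * a ^ n / (\<bar>c\<bar> + 1)"
      using mult_less_cancel_left_pos[of "ln a ^ r"] ln by (simp del: times_divide_eq_right)
    then have "(\<bar>c\<bar> + 1) * (real n + 1) ^ r < b * a ^ n"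
      by (simp add: field_simps)
    moreover have "c * (real n + 1) ^ r \<le> (\<bar>c\<bar> + 1) * (real n + 1) ^ r"
      by (intro mult_right_mono) auto
    ultimately show ?case by linarith
  qed
qed

lemma between_powers:
  fixes \<gamma> x :: real
  assumes "\<gamma> > 1" "x \<ge> 1"
  obtains k where "\<gamma> ^ k \<le> x" "x < \<gamma> ^ Suc k"
proof -
  define j where "j = (LEAST j. x < \<gamma> ^ j)"
  have j: "x < \<gamma> ^ j"
    unfolding j_def using real_arch_pow[OF assms(1), of x] by (rule LeastI_ex)
  then obtain k where k: "j = Suc k" using assms(2) by (cases j) auto
  then have "k < (LEAST j. x < \<gamma> ^ j)" by (simp add: j_def[symmetric])
  then have "\<not> x < \<gamma> ^ k" by (rule not_less_Least)
  with j k show thesis by (intro that[of k]) simp_all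
qed

text \<open>For \<open>\<gamma> > 1\<close> the exponent \<open>k\<close> is at most the logarithm of \<open>x\<close> to the base \<open>\<gamma>\<close>, and an exponential
in the logarithm of \<open>x\<close> is polynomial in \<open>x\<close>.\<close>
lemma power_le_of_power_le:
  fixes \<gamma> c x :: real
  assumes "0 \<le> c" "c \<le> \<gamma> ^ m" "0 \<le> \<gamma>" "\<gamma> ^ k \<le> x"
  shows "c ^ Suc k \<le> c * x ^ m"
proof -
  have "c ^ k \<le> (\<gamma> ^ m) ^ k" using assms(1,2) by (intro power_mono) auto
  also have "\<dots> = (\<gamma> ^ k) ^ m" by (simp add: power_mult[symmetric] mult.commute)
  also have "\<dots> \<le> x ^ m" using assms(3,4) by (intro power_mono) auto
  finally show ?thesis using assms(1) by (simp add: mult_left_mono)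
qed

theorem theorem1:
  fixes G :: "('a, 'm) monoid_scheme"
    and gens :: "'a set"
    and S1 S2 :: "nat \<Rightarrow> 'a set"
  assumes "group G"
    and "finite gens"
    and "semigroup_generates G gens"
    and "\<And>n. S1 n \<subseteq> carrier G"
    and "\<And>n. S2 n \<subseteq> carrier G"
    and "\<And>n g. g \<in> S1 n \<Longrightarrow> \<exists>w \<in> lists gens. length w \<le> n \<and> word_val G w = g"
    and "\<And>n g. g \<in> S2 n \<Longrightarrow> \<exists>w \<in> lists gens. length w \<le> n \<and> word_val G w = g"
    and "\<exists>\<alpha>0 \<alpha>1 :: real. \<alpha>0 > 0 \<and> \<alpha>1 > 1 \<and>
           infinite {n. real (card (S1 n)) \<ge> \<alpha>0 * \<alpha>1 ^ n \<and> real (card (S2 n)) \<ge> \<alpha>0 * \<alpha>1 ^ n}"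
    and "\<And>n g h. g \<in> S1 n \<Longrightarrow> h \<in> S2 n \<Longrightarrow> g \<otimes>\<^bsub>G\<^esub> h = h \<otimes>\<^bsub>G\<^esub> g"
  shows "\<forall>X. finite X \<and> semigroup_generates G X \<longrightarrow> \<not> has_nca G X"
proof (intro allI impI notI, elim conjE)
  fix X assume X: "finite X" "semigroup_generates G X" "has_nca G X"
  interpret group G by fact
  obtain M :: "('a + nat) nca" where M: "is_nca M" "input_alphabet M = Inl ` X"
    "nca_language M = map Inl ` word_problem G X"
    using X(3) unfolding has_nca_def by blast
  define R where "R = marked_rules M"
  define Al where "Al = marked_alphabet M"
  obtain K where K: "K \<ge> 1" "\<forall>(v, u) \<in> R. length u < length v \<and> length v \<le> K" "finite R" "finite Al"
    "R \<subseteq> lists Al \<times> lists Al"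
    using marked_rules_properties[OF M(1)] unfolding R_def Al_def by blast
  have X_G: "X \<subseteq> carrier G" using X(2) unfolding semigroup_generates_def by blast
  have gens_G: "gens \<subseteq> carrier G" using assms(3) unfolding semigroup_generates_def by blast
  have inputs: "map Inl w \<in> lists (input_alphabet M)" if "w \<in> lists X" for w :: "'a list"
    using that M(2) by auto
  have embed: "wrap (map Inl w) \<in> lists Al" if "w \<in> lists X" for w :: "'a list"
  proof -
    have "map Inl w \<in> lists (work_alphabet M)"
      using inputs[OF that] M(1) unfolding is_nca_def by auto
    then show ?thesis unfolding Al_def by (rule mark_in_alphabet)
  qed
  have language: "(rewrite R)\<^sup>*\<^sup>* (wrap (map Inl w)) (wrap []) \<longleftrightarrow> word_val G w = \<one>\<^bsub>G\<^esub>"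
    if "w \<in> lists X" for w :: "'a list"
  proof -
    have "(map Inl w :: ('a + nat) list) \<in> map Inl ` word_problem G X \<longleftrightarrow> w \<in> word_problem G X"
      by (intro inj_image_mem_iff) simp
    then show ?thesis
      using nca_language_iff[OF M(1) inputs[OF that]] that M(3)
      by (simp add: R_def word_problem_def)
  qed
  obtain L where L: "L \<ge> 1" "\<And>w. w \<in> lists gens \<Longrightarrow> \<exists>x \<in> lists X. x \<noteq> [] \<and>
      length x \<le> L * (length w + 1) \<and> word_val G x = word_val G w"
    "\<And>w. w \<in> lists gens \<Longrightarrow> \<exists>x \<in> lists X.
      length x \<le> L * (length w + 1) \<and> word_val G x = inv\<^bsub>G\<^esub> (word_val G w)"
    using short_words[OF assms(2) gens_G X(1,2)] by blast
  have word: "\<exists>w \<in> lists gens. length w \<le> n \<and> word_val G w = g" if "g \<in> S1 n \<union> S2 n" for n g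
    using that assms(6,7) by blast
  have words: "\<exists>x\<in>lists X. x \<noteq> [] \<and> length x \<le> L * (n + 1) \<and> word_val G x = g"
    "\<exists>x\<in>lists X. length x \<le> L * (n + 1) \<and> word_val G x = inv\<^bsub>G\<^esub> g"
    if g: "g \<in> S1 n \<union> S2 n" for n g
  proof -
    obtain w where w: "w \<in> lists gens" "length w \<le> n" "word_val G w = g" using word[OF g] by blast
    then have "L * (length w + 1) \<le> L * (n + 1)" by simp
    with L(2,3)[OF w(1)] w(3)
    show "\<exists>x\<in>lists X. x \<noteq> [] \<and> length x \<le> L * (n + 1) \<and> word_val G x = g"
      "\<exists>x\<in>lists X. length x \<le> L * (n + 1) \<and> word_val G x = inv\<^bsub>G\<^esub> g"
      by (meson order_trans)+
  qed
  define \<gamma> :: real where "\<gamma> = 1 + 1 / real K"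
  have \<gamma>: "\<gamma> > 1" using K(1) by (simp add: \<gamma>_def)
  \<comment> \<open>One more than the number of crossings, so that a power of it also counts the shorter lists.\<close>
  define c where "c = card (crossings R K) + 1"
  define Z where "Z = card {z. set z \<subseteq> Al \<and> length z \<le> K}"
  \<comment> \<open>The degree of the polynomial bound depends only on the rewriting system.\<close>
  obtain m where m: "real c < \<gamma> ^ m" using real_arch_pow[OF \<gamma>] by blast
  \<comment> \<open>A bound for the length of the four words of a commutator and the two end markers.\<close>
  define N where "N n = 4 * (L * (n + 1)) + 2" for n
  have bound: "real (card (S1 n)) * real (card (S2 n))
      \<le> real Z * real c ^ 2 * real (N n) ^ (2 * m + 2) * (real (card (S1 n)) + real (card (S2 n)))"
    if fin: "finite (S1 n)" "finite (S2 n)" for n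
  proof -
    obtain k where k: "\<gamma> ^ k \<le> real (N n)" "real (N n) < \<gamma> ^ Suc k"
      by (rule between_powers[OF \<gamma>, of "real (N n)"]) (simp_all add: N_def)
    have ck: "real c ^ Suc k \<le> real c * real (N n) ^ m"
      using m \<gamma> k(1) by (intro power_le_of_power_le) auto
    have "L * (n + 1) + 2 \<le> N n" by (simp add: N_def)
    then have lN: "real (L * (n + 1) + 2) \<le> real (N n)" by (simp only: of_nat_le_iff)
    let ?D = "{..L * (n + 1) + 1} \<times> {..L * (n + 1) + 1} \<times> cut_labels R K Al (Suc k)"
    have "card (S1 n) * card (S2 n) \<le> card ?D * (card (S1 n) + card (S2 n))"
      by (rule commuting_sets_bound[where e = Inl and X = X])
        (fact K embed language X_G fin assms(4,5,9) words k(2)[unfolded N_def \<gamma>_def])+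
    then have prod: "real (card (S1 n)) * real (card (S2 n))
        \<le> real (card ?D) * (real (card (S1 n)) + real (card (S2 n)))"
      by (simp only: of_nat_add[symmetric] of_nat_mult[symmetric] of_nat_le_iff)
    have "real (card (cut_labels R K Al (Suc k))) \<le> real (c ^ Suc k * c ^ Suc k * Z)"
      using card_cut_labels(2)[OF K(3,4), of K "Suc k"] unfolding c_def Z_def by (simp only: of_nat_le_iff)
    also have "\<dots> = real c ^ Suc k * real c ^ Suc k * real Z" by simp
    also have "\<dots> \<le> (real c * real (N n) ^ m) * (real c * real (N n) ^ m) * real Z"
      using ck by (intro mult_mono) (auto simp: c_def)
    finally have labels: "real (card (cut_labels R K Al (Suc k)))
        \<le> (real c * real (N n) ^ m) * (real c * real (N n) ^ m) * real Z" .
    have "real (card ?D) = real (L * (n + 1) + 2) * (real (L * (n + 1) + 2) * real (card (cut_labels R K Al (Suc k))))"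
      by (simp add: card_cartesian_product algebra_simps)
    also have "\<dots> \<le> real (N n) * (real (N n) * ((real c * real (N n) ^ m) * (real c * real (N n) ^ m) * real Z))"
      by (intro mult_mono lN labels) auto
    also have "\<dots> = real Z * real c ^ 2 * real (N n) ^ (2 * m + 2)"
      by (simp add: power_add mult_2 mult_2_right power2_eq_square mult_ac)
    finally have "real (card ?D) \<le> real Z * real c ^ 2 * real (N n) ^ (2 * m + 2)" .
    then have "real (card ?D) * (real (card (S1 n)) + real (card (S2 n)))
      \<le> real Z * real c ^ 2 * real (N n) ^ (2 * m + 2) * (real (card (S1 n)) + real (card (S2 n)))"
      by (intro mult_right_mono) auto
    with prod show ?thesis by linarith
  qed
  obtain \<alpha>0 \<alpha>1 :: real where \<alpha>: "\<alpha>0 > 0" "\<alpha>1 > 1"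
    "infinite {n. real (card (S1 n)) \<ge> \<alpha>0 * \<alpha>1 ^ n \<and> real (card (S2 n)) \<ge> \<alpha>0 * \<alpha>1 ^ n}"
    using assms(8) by blast
  define C where "C = 2 * (real Z * real c ^ 2 * (6 * real L) ^ (2 * m + 2))"
  have "eventually (\<lambda>n. C * (real n + 1) ^ (2 * m + 2) < \<alpha>0 * \<alpha>1 ^ n) sequentially"
    by (rule polynomial_less_exponential[OF \<alpha>(2,1)])
  then obtain n0 where n0: "\<And>n. n \<ge> n0 \<Longrightarrow> C * (real n + 1) ^ (2 * m + 2) < \<alpha>0 * \<alpha>1 ^ n"
    unfolding eventually_sequentially by blast
  obtain n where n: "n \<ge> n0" "real (card (S1 n)) \<ge> \<alpha>0 * \<alpha>1 ^ n" "real (card (S2 n)) \<ge> \<alpha>0 * \<alpha>1 ^ n"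
    using \<alpha>(3) unfolding finite_nat_set_iff_bounded by (auto simp: not_less)
  have pos: "\<alpha>0 * \<alpha>1 ^ n > 0" using \<alpha> by simp
  have "card (S1 n) > 0" "card (S2 n) > 0" using n pos by linarith+
  then have fin: "finite (S1 n)" "finite (S2 n)" by (simp_all add: card_gt_0_iff)
  define q where "q = real Z * real c ^ 2 * real (N n) ^ (2 * m + 2)"
  have "real (N n) \<le> 6 * real L * (real n + 1)"
  proof -
    have "1 * 1 \<le> real L * (real n + 1)" using L(1) by (intro mult_mono) auto
    then show ?thesis by (simp add: N_def algebra_simps)
  qed
  then have "real (N n) ^ (2 * m + 2) \<le> (6 * real L * (real n + 1)) ^ (2 * m + 2)"
    by (intro power_mono) auto
  then have "q \<le> real Z * real c ^ 2 * (6 * real L * (real n + 1)) ^ (2 * m + 2)"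
    unfolding q_def by (intro mult_left_mono) auto
  moreover have "C * (real n + 1) ^ (2 * m + 2)
      = 2 * (real Z * real c ^ 2 * (6 * real L * (real n + 1)) ^ (2 * m + 2))"
    unfolding C_def power_mult_distrib[of "6 * real L" "real n + 1"] by (simp only: mult.assoc)
  ultimately have "2 * q \<le> C * (real n + 1) ^ (2 * m + 2)" by linarith
  with n0[OF n(1)] have small: "2 * q < \<alpha>0 * \<alpha>1 ^ n" by linarith
  let ?a = "real (card (S1 n))" and ?b = "real (card (S2 n))"
  have "?a * ?b \<le> q * (?a + ?b)" using bound[OF fin] by (simp add: q_def)
  moreover have "2 * q < ?a" "2 * q < ?b" "0 < ?a" "0 < ?b" using small n pos by linarith+
  then have "2 * q * ?b < ?a * ?b" "2 * q * ?a < ?b * ?a"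
    by (simp_all only: mult_strict_right_mono)
  ultimately show False by (simp add: algebra_simps)
qed

end
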